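(* Given any $\epsilon>0$, there exists a finitely generated subsemigroup $\Gamma\subseteq\mathrm{SL}(2, \mathbb{Z})^{\geq 0}$ with Hausdorff dimension $1-\epsilon < \delta < 1$ that exhibits reciprocity obstructions.
   Context: $\mathrm{SL}(2,\mathbb{Z})^{\geq 0}$ is the semigroup of matrices in $\mathrm{SL}(2,\mathbb{Z})$ with all entries nonnegative. The Hausdorff dimension of a subsemigroup $\Gamma\subseteq\mathrm{SL}(2,\mathbb{Z})^{\geq 0}$ means the Hausdorff dimension of its limit set $\Lambda(\Gamma)=\{\lim_{n\to\infty}\gamma_0\cdots\gamma_n(1):\gamma_j\in\Gamma\setminus\{I\}\}$, with matrices acting by Möbius transformations. For a vector $\begin{pmatrix} u\\ v\end{pmatrix}$ in an orbit $\Gamma\begin{pmatrix} x\\ y\end{pmatrix}$, $u$ is the numerator and $v$ the denominator. An orbit $\Gamma\begin{pmatrix} x\\ y\end{pmatrix}$ exhibits reciprocity obstructions if the set $X$ of its numerators (or, respectively, denominators) satisfies: (1) for all $n\ge 1$ the residues modulo $n$ of $X$ include squares; but (2) $X$ contains no integer squares. The semigroup exhibits reciprocity obstructions if at least one orbit does. *)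

theory Defs
  imports "HOL-Analysis.Analysis" "HOL-Number_Theory.Cong"
begin

subsection \<open>Hausdorff measure and dimension\<close>

text \<open>The case distinction implements the convention that the diameter to the power 0 is 1 for
  every nonempty set, whereas \<open>0 powr 0 = 0\<close> in the library; empty sets contribute 0.\<close>

definition diam_powr :: "real \<Rightarrow> 'a::metric_space set \<Rightarrow> ennreal" where
  "diam_powr s U =
     (if U = {} then 0 else if s = 0 then 1 else ennreal (diameter U powr s))"

text \<open>Boundedness of the covering sets is required explicitly because \<open>diameter\<close> is not
  meaningful on unbounded sets. Finite covers are included since the \<open>U i\<close> may be empty.\<close>

definition hausdorff_premeasure :: "real \<Rightarrow> real \<Rightarrow> 'a::metric_space set \<Rightarrow> ennreal" where
  "hausdorff_premeasure s r A =
     (INF U \<in> {U :: nat \<Rightarrow> 'a set. A \<subseteq> (\<Union>i. U i) \<and> (\<forall>i. bounded (U i) \<and> diameter (U i) \<le> r)}.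
        \<Sum>i. diam_powr s (U i))"

definition hausdorff_measure :: "real \<Rightarrow> 'a::metric_space set \<Rightarrow> ennreal" where
  "hausdorff_measure s A = (SUP r \<in> {0<..}. hausdorff_premeasure s r A)"

definition hausdorff_dim :: "'a::metric_space set \<Rightarrow> ereal" where
  "hausdorff_dim A = Inf (ereal ` {s. 0 \<le> s \<and> hausdorff_measure s A = 0})"

subsection \<open>Subsemigroups of nonnegative matrices\<close>

definition SL2Z_nonneg :: "(int^2^2) set" where
  "SL2Z_nonneg = {M. det M = 1 \<and> (\<forall>i j. 0 \<le> M $ i $ j)}"

inductive_set semigroup_generated :: "(int^2^2) set \<Rightarrow> (int^2^2) set"
  for S :: "(int^2^2) set" where
  gen: "M \<in> S \<Longrightarrow> M \<in> semigroup_generated S"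
| mult: "M \<in> semigroup_generated S \<Longrightarrow> N \<in> semigroup_generated S \<Longrightarrow> M ** N \<in> semigroup_generated S"

text \<open>The identity matrix need not belong to a subsemigroup, but it may be one of the generators.\<close>

definition fin_gen_semigroup :: "(int^2^2) set \<Rightarrow> bool" where
  "fin_gen_semigroup \<Gamma> \<longleftrightarrow> (\<exists>S. finite S \<and> \<Gamma> = semigroup_generated S)"

subsection \<open>Limit sets\<close>

definition moebius :: "int^2^2 \<Rightarrow> real \<Rightarrow> real" where
  "moebius M z = (of_int (M$1$1) * z + of_int (M$1$2)) / (of_int (M$2$1) * z + of_int (M$2$2))"

primrec partial_prod :: "(nat \<Rightarrow> int^2^2) \<Rightarrow> nat \<Rightarrow> int^2^2" where
  "partial_prod \<gamma> 0 = \<gamma> 0"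
| "partial_prod \<gamma> (Suc n) = partial_prod \<gamma> n ** \<gamma> (Suc n)"

text \<open>For nonnegative matrices of determinant 1 the Moebius image of 1 is a positive real number
  (its denominator is a positive bottom row sum), but the limit can be \<open>\<infinity>\<close>, for instance
  for a constant sequence of upper triangular matrices.\<close>

definition limit_set :: "(int^2^2) set \<Rightarrow> ereal set" where
  "limit_set \<Gamma> =
     {l. \<exists>\<gamma>. (\<forall>j. \<gamma> j \<in> \<Gamma> - {mat 1}) \<and> (\<lambda>n. ereal (moebius (partial_prod \<gamma> n) 1)) \<longlonglongrightarrow> l}"

text \<open>The dimension is measured on the finite part of the limit set: dropping the single
  point \<open>\<infinity>\<close> does not affect Hausdorff dimension.\<close>

definition semigroup_dim :: "(int^2^2) set \<Rightarrow> ereal" where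
  "semigroup_dim \<Gamma> = hausdorff_dim {x :: real. ereal x \<in> limit_set \<Gamma>}"

subsection \<open>Reciprocity obstructions\<close>

definition orbit :: "(int^2^2) set \<Rightarrow> int^2 \<Rightarrow> (int^2) set" where
  "orbit \<Gamma> v = (\<lambda>M. M *v v) ` \<Gamma>"

definition numerators :: "(int^2) set \<Rightarrow> int set" where
  "numerators V = (\<lambda>w. w $ 1) ` V"

definition denominators :: "(int^2) set \<Rightarrow> int set" where
  "denominators V = (\<lambda>w. w $ 2) ` V"

definition square_obstruction :: "int set \<Rightarrow> bool" where
  "square_obstruction X \<longleftrightarrow>
     (\<forall>n::int. n \<ge> 1 \<longrightarrow> (\<exists>u\<in>X. \<exists>s::int. [u = s\<^sup>2] (mod n))) \<and>
     (\<forall>u\<in>X. \<not> (\<exists>s::int. u = s\<^sup>2))"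

definition orbit_reciprocity_obstruction :: "(int^2) set \<Rightarrow> bool" where
  "orbit_reciprocity_obstruction V \<longleftrightarrow>
     square_obstruction (numerators V) \<or> square_obstruction (denominators V)"

text \<open>Orbits are those of nonnegative vectors. For vectors such as \<open>(-1, -1)\<close> all
  numerators and denominators would be negative, hence trivially nonsquares.\<close>

definition exhibits_reciprocity_obstructions :: "(int^2^2) set \<Rightarrow> bool" where
  "exhibits_reciprocity_obstructions \<Gamma> \<longleftrightarrow>
     (\<exists>v. 0 \<le> v $ 1 \<and> 0 \<le> v $ 2 \<and> orbit_reciprocity_obstruction (orbit \<Gamma> v))"

end

theory Submission
  imports Defs "HOL-Number_Theory.Number_Theory" "HOL-Real_Asymp.Real_Asymp"
begin

text \<open>On nonnegative matrices (a, b; c, d) with c divisible by 4 and d congruent to 1 modulo 4,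
  quadratic reciprocity turns the Jacobi symbol (c/d) into a character that governs the action on
  the symbol (x/y) of a column vector. A semigroup in the kernel of this character therefore
  preserves (x/y) = -1 along the orbit of (2, 5), so no numerator is a square; local squares are
  present because modulo every n the semigroup is a group containing the image of (1, 1; 0, 1)
  and (1, 0; 4, 1), which reaches the numerator 4.

  The kernel is large: for each d at least half of the residues prime to d have symbol 1, so there
  are N^2 / log N matrices with c and d of size N whose images of an interval are disjoint and have
  length comparable to N^(-2). Since N^2 (N^(-2))^s outgrows log N for s < 1, the limit sets of
  these finite systems have dimension tending to 1, while a gap left by the images of the
  generators keeps each of these dimensions below 1.\<close>

subsection \<open>The Jacobi symbol\<close>

text \<open>Reaching the numerator 4 modulo every n while no numerator is a square looks
  contradictory. The sign resolves it: the word behind 4 uses inverse matrices and leads to (4, -7),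
  whereas the invariance of the symbol concerns vectors with positive entries, and a congruence does
  not see the sign. The two bounds on the dimension pull in opposite directions, and the local
  condition asks for two further generators. These tasks are assigned to separate parts of [1, 4]:
  \<open>gen1\<close> and \<open>gen2\<close> map it into [1, 5/4] and [2, 9/4], the large block
  maps it into [3, 4], and [5/2, 11/4] stays free. The lower bound is proved for the block alone,
  whose contraction ratios all have order N^(-2), so that counting its elements suffices; the upper
  bound concerns the whole system and uses no more than the free interval.\<close>

lemma Legendre_mult:
  fixes a b p :: int
  assumes "prime p" "2 < p"
  shows "Legendre (a * b) p = Legendre a p * Legendre b p"
proof -
  have p: "prime (nat p)" "2 < nat p" "int (nat p) = p"
    using assms by simp_all
  have "[Legendre (a * b) p = (a * b) ^ ((nat p - 1) div 2)] (mod p)"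
    using euler_criterion[OF p(1,2), of "a * b"] p(3) by simp
  moreover have "[Legendre a p * Legendre b p = a ^ ((nat p - 1) div 2) * b ^ ((nat p - 1) div 2)] (mod p)"
    using cong_mult[OF euler_criterion[OF p(1,2), of a] euler_criterion[OF p(1,2), of b]] p(3)
    by simp
  ultimately have "[Legendre (a * b) p = Legendre a p * Legendre b p] (mod p)"
    by (simp add: cong_def power_mult_distrib)
  then have "p dvd Legendre (a * b) p - Legendre a p * Legendre b p"
    by (simp add: cong_iff_dvd_diff)
  \<comment> \<open>Euler's criterion yields a congruence only; two numbers in {-1, 0, 1} that agree
    modulo p > 2 are equal.\<close>
  moreover have "\<bar>Legendre (a * b) p - Legendre a p * Legendre b p\<bar> \<le> 2"
    by (auto simp: Legendre_def)
  ultimately have "Legendre (a * b) p - Legendre a p * Legendre b p = 0"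
    using assms(2) dvd_imp_le_int[of "Legendre (a * b) p - Legendre a p * Legendre b p" p] by linarith
  then show ?thesis by simp
qed

text \<open>On \<open>int\<close>, \<open>prime_factorization\<close> lists positive primes with
  multiplicity, so for odd n this is the Jacobi symbol modulo |n|; \<open>jacobi a 0\<close> is the
  empty product 1. At even n it is not the Kronecker symbol.\<close>

definition jacobi :: "int \<Rightarrow> int \<Rightarrow> int" where
  "jacobi a n = (\<Prod>p\<in>#prime_factorization n. Legendre a p)"

lemma jacobi_one_right [simp]: "jacobi a 1 = 1"
  by (simp add: jacobi_def)

lemma jacobi_prime: "prime p \<Longrightarrow> jacobi a p = Legendre a p"
  by (simp add: jacobi_def prime_factorization_prime)

lemma jacobi_mult_right: "m \<noteq> 0 \<Longrightarrow> n \<noteq> 0 \<Longrightarrow> jacobi a (m * n) = jacobi a m * jacobi a n"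
  by (simp add: jacobi_def prime_factorization_mult)

lemma odd_prime_factor_gt_2:
  fixes n p :: int
  assumes "odd n" "p \<in># prime_factorization n"
  shows "prime p" "2 < p"
proof -
  show p: "prime p" using assms(2) by (auto simp: in_prime_factors_iff)
  have "p dvd n" using assms(2) by (auto simp: in_prime_factors_iff)
  with assms(1) have "p \<noteq> 2" by auto
  with prime_ge_2_int[OF p] show "2 < p" by simp
qed

lemma jacobi_mult_left:
  assumes "odd n"
  shows "jacobi (a * b) n = jacobi a n * jacobi b n"
  unfolding jacobi_def prod_mset.distrib [symmetric]
  by (intro arg_cong[where f = prod_mset] image_mset_cong Legendre_mult odd_prime_factor_gt_2[OF assms])

lemma jacobi_cong:
  assumes "[a = b] (mod n)"
  shows "jacobi a n = jacobi b n"
  unfolding jacobi_def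
proof (intro arg_cong[where f = prod_mset] image_mset_cong)
  fix p assume "p \<in># prime_factorization n"
  then have "p dvd n" by (auto simp: in_prime_factors_iff)
  then have "[a = b] (mod p)" using assms cong_dvd_modulus by blast
  then have "[y = a] (mod p) \<longleftrightarrow> [y = b] (mod p)" for y
    by (simp add: cong_def)
  moreover have "[a = 0] (mod p) \<longleftrightarrow> [b = 0] (mod p)"
    using \<open>[a = b] (mod p)\<close> by (simp add: cong_def)
  ultimately show "Legendre a p = Legendre b p"
    by (simp add: Legendre_def QuadRes_def)
qed

lemma jacobi_coprime:
  assumes "coprime a n"
  shows "jacobi a n = 1 \<or> jacobi a n = -1"
proof -
  have "Legendre a p = 1 \<or> Legendre a p = -1" if "p \<in># prime_factorization n" for p
  proof -
    have "prime p" "p dvd n" using that by (auto simp: in_prime_factors_iff)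
    then have "\<not> p dvd a" using assms by (meson coprime_common_divisor not_prime_unit)
    then show ?thesis by (simp add: Legendre_def cong_0_iff)
  qed
  moreover have "(\<Prod>p\<in>#A. f p) = 1 \<or> (\<Prod>p\<in>#A. f p) = -1"
    if "\<And>p. p \<in># A \<Longrightarrow> f p = 1 \<or> f p = -1" for A and f :: "int \<Rightarrow> int"
    using that
  proof (induction A)
    case (add x A)
    then have "f x = 1 \<or> f x = -1" "(\<Prod>p\<in>#A. f p) = 1 \<or> (\<Prod>p\<in>#A. f p) = -1" by auto
    then show ?case by auto
  qed simp
  ultimately show ?thesis unfolding jacobi_def by blast
qed


lemma jacobi_not_coprime:
  assumes "\<not> coprime a n" "n \<noteq> 0"
  shows "jacobi a n = 0"
proof -
  have "\<not> is_unit (gcd a n)" "gcd a n \<noteq> 0" using assms by (auto simp: is_unit_gcd)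
  then obtain p where p: "prime p" "p dvd gcd a n"
    using prime_divisor_exists by blast
  then have "p \<in># prime_factorization n" using assms(2) by (auto simp: in_prime_factors_iff)
  moreover have "Legendre a p = 0" using p by (simp add: Legendre_def cong_0_iff)
  ultimately show ?thesis unfolding jacobi_def by (force simp: prod_mset_zero_iff)
qed

section \<open>Quadratic reciprocity for Jacobi symbols\<close>

definition recip_sign :: "int \<Rightarrow> int \<Rightarrow> int" where
  "recip_sign m n = (if m mod 4 = 3 \<and> n mod 4 = 3 then -1 else 1)"

lemma odd_mod_4_cases: "odd n \<Longrightarrow> n mod 4 = 1 \<or> n mod 4 = (3::int)"
  by presburger

lemma odd_mult_mod_4:
  fixes m n :: int
  assumes "odd m" "odd n"
  shows "(m * n) mod 4 = (if m mod 4 = n mod 4 then 1 else 3)"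
proof -
  have "(m * n) mod 4 = ((m mod 4) * (n mod 4)) mod 4"
    by (simp only: mod_mult_eq)
  then show ?thesis
    using odd_mod_4_cases[OF assms(1)] odd_mod_4_cases[OF assms(2)] by (elim disjE) simp_all
qed

lemma recip_sign_mult_left:
  assumes "odd m" "odd m'"
  shows "recip_sign (m * m') n = recip_sign m n * recip_sign m' n"
  using odd_mod_4_cases[OF assms(1)] odd_mod_4_cases[OF assms(2)]
  by (auto simp: recip_sign_def odd_mult_mod_4[OF assms])

lemma recip_sign_commute: "recip_sign m n = recip_sign n m"
  by (auto simp: recip_sign_def)

lemma odd_prime_int_mod_4:
  fixes p :: int
  assumes "prime p" "2 < p"
  shows "odd p" "p mod 4 = 1 \<and> even ((p - 1) div 2) \<or> p mod 4 = 3 \<and> odd ((p - 1) div 2)"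
proof -
  show "odd p" using assms prime_odd_int by auto
  then show "p mod 4 = 1 \<and> even ((p - 1) div 2) \<or> p mod 4 = 3 \<and> odd ((p - 1) div 2)"
    by presburger
qed

text \<open>With one symbol on each side the law also covers p = q, where both symbols are 0; the
  induction over prime factors can then run without separating common factors.\<close>

lemma Legendre_reciprocity:
  fixes p q :: int
  assumes "prime p" "2 < p" "prime q" "2 < q"
  shows "Legendre p q = recip_sign p q * Legendre q p"
proof (cases "p = q")
  case True
  then show ?thesis by (simp add: Legendre_def cong_def)
next
  case False
  have pq: "prime (nat p)" "prime (nat q)" using assms by simp_all
  have "even (nat ((p - 1) div 2 * ((q - 1) div 2))) \<longleftrightarrow> even ((p - 1) div 2 * ((q - 1) div 2))"
    using assms by (simp add: even_nat_iff)
  \<comment> \<open>\<open>recip_sign\<close> is the usual sign (-1)^((p-1)/2 * (q-1)/2), written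
    through residues modulo 4 so that its multiplicativity is a finite check.\<close>
  then have "(-1::int) ^ (nat ((p - 1) div 2 * ((q - 1) div 2))) = recip_sign p q"
    using odd_prime_int_mod_4[OF assms(1,2)] odd_prime_int_mod_4[OF assms(3,4)]
    by (auto simp: recip_sign_def uminus_power_if)
  then have *: "Legendre p q * Legendre q p = recip_sign p q"
    using Quadratic_Reciprocity_int[OF pq(1) assms(2) pq(2) assms(4) False] by simp
  then have "Legendre q p \<noteq> 0" by (auto simp: recip_sign_def split: if_splits)
  then have "Legendre q p * Legendre q p = 1" by (auto simp: Legendre_def)
  then have "Legendre p q = Legendre p q * Legendre q p * Legendre q p" by simp
  with * show ?thesis by simp
qed

lemma pos_odd_int_induct [consumes 2, case_names one factor]:
  fixes n :: int
  assumes "0 < n" "odd n"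
    and "P 1"
    and "\<And>p n. prime p \<Longrightarrow> 2 < p \<Longrightarrow> 0 < n \<Longrightarrow> odd n \<Longrightarrow> P n \<Longrightarrow> P (p * n)"
  shows "P n"
  using assms(1,2)
proof (induction n rule: prime_divisors_induct)
  case (unit x)
  then show ?case using assms(3) by simp
next
  case (factor p x)
  then have "0 < p" by (simp add: prime_gt_0_int)
  with factor have "0 < x" "odd x" "odd p" by (auto simp: zero_less_mult_iff)
  moreover have "2 < p" using prime_ge_2_int[OF factor.hyps(1)] \<open>odd p\<close> by (cases "p = 2") auto
  ultimately show ?case using factor assms(4) by blast
qed simp

lemma jacobi_one_left [simp]: "jacobi 1 n = 1"
proof -
  have "Legendre 1 p = 1" if "p \<in># prime_factorization n" for p
  proof -
    have "prime p" using that by (auto simp: in_prime_factors_iff)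
    then have "\<not> p dvd 1" using not_prime_unit by blast
    moreover have "QuadRes p 1" unfolding QuadRes_def by (rule exI[of _ 1]) simp
    ultimately show ?thesis by (simp add: Legendre_def cong_0_iff)
  qed
  then have "image_mset (Legendre 1) (prime_factorization n) = image_mset (\<lambda>_. 1) (prime_factorization n)"
    by (intro image_mset_cong)
  then show ?thesis by (simp add: jacobi_def)
qed

text \<open>Symbol and sign are multiplicative in both arguments, so the law spreads from pairs of
  primes: the factors of n are collected for prime m, then those of m.\<close>

theorem jacobi_reciprocity:
  assumes "0 < m" "odd m" "0 < n" "odd n"
  shows "jacobi m n = recip_sign m n * jacobi n m"
proof -
  have prime: "jacobi p n = recip_sign p n * jacobi n p"
    if "prime p" "2 < p" "0 < n" "odd n" for p n :: int
    using that(3,4)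
  proof (induction n rule: pos_odd_int_induct)
    case one
    then show ?case by (simp add: recip_sign_def)
  next
    case (factor q n)
    then have "jacobi p (q * n) = (recip_sign p q * Legendre q p) * (recip_sign p n * jacobi n p)"
      using Legendre_reciprocity[OF that(1,2) factor(1,2)] by (simp add: jacobi_mult_right jacobi_prime)
    also have "\<dots> = (recip_sign q p * recip_sign n p) * (jacobi q p * jacobi n p)"
      using that(1) by (simp add: jacobi_prime recip_sign_commute)
    also have "\<dots> = recip_sign p (q * n) * jacobi (q * n) p"
      using factor odd_prime_int_mod_4(1) that(1,2)
      by (simp add: jacobi_mult_left recip_sign_mult_left recip_sign_commute[of p])
    finally show ?case .
  qed
  show ?thesis using assms(1,2)
  proof (induction m rule: pos_odd_int_induct)
    case one
    then show ?case by (simp add: recip_sign_def)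
  next
    case (factor p m)
    then show ?case
      using prime[OF factor(1,2) assms(3,4)] odd_prime_int_mod_4(1)[OF factor(1,2)] assms
      by (simp add: jacobi_mult_left jacobi_mult_right recip_sign_mult_left)
  qed
qed

lemma jacobi_swap:
  assumes "0 < m" "odd m" "0 < n" "n mod 4 = 1"
  shows "jacobi m n = jacobi n m"
proof -
  have "odd n" using assms(4) by presburger
  then show ?thesis using jacobi_reciprocity[of m n] assms by (simp add: recip_sign_def)
qed

section \<open>Supplementary laws and periodicity in the lower argument\<close>

lemma jacobi_minus_one:
  assumes "0 < n" "odd n"
  shows "jacobi (-1) n = (if n mod 4 = 1 then 1 else -1)"
  using assms
proof (induction n rule: pos_odd_int_induct)
  case (factor p n)
  have p: "prime (nat p)" "2 < nat p" "int (nat p) = p" "odd p"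
    using factor odd_prime_int_mod_4(1) by simp_all
  have e: "(nat p - 1) div 2 = nat ((p - 1) div 2)" using factor by linarith
  have "[Legendre (-1) p = (-1) ^ nat ((p - 1) div 2)] (mod p)"
    using euler_criterion[OF p(1,2), of "-1"] p(3) e by simp
  then have "p dvd Legendre (-1) p - (-1) ^ nat ((p - 1) div 2)"
    by (simp add: cong_iff_dvd_diff)
  moreover have "\<bar>Legendre (-1) p - (-1) ^ nat ((p - 1) div 2)\<bar> \<le> 2"
    by (auto simp: Legendre_def uminus_power_if)
  ultimately have "Legendre (-1) p - (-1) ^ nat ((p - 1) div 2) = 0"
    using factor(2) dvd_imp_le_int[of "Legendre (-1) p - (-1) ^ nat ((p - 1) div 2)" p] by linarith
  then have "Legendre (-1) p = (if p mod 4 = 1 then 1 else -1)"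
    using odd_prime_int_mod_4(2)[OF factor(1,2)] factor(2)
    by (auto simp: uminus_power_if even_nat_iff)
  then show ?case
    using factor odd_mod_4_cases[OF p(4)] odd_mod_4_cases[OF factor(4)]
    by (auto simp: jacobi_mult_right jacobi_prime odd_mult_mod_4[OF p(4) factor(4)])
qed simp

text \<open>The dependence of (2/n) on n modulo 8, obtained from reciprocity alone:
  (2/n) = ((n+2)/n), and n is congruent to -2 modulo n + 2.\<close>

lemma jacobi_two_add_4:
  assumes "0 < n" "n mod 4 = 1"
  shows "jacobi 2 (n + 4) = - jacobi 2 n"
proof -
  have m4: "(n + 2) mod 4 = 3" "(n + 4) mod 4 = 1" and o: "odd n" using assms(2) by presburger+
  have m: "jacobi (-2) k = jacobi (-1) k * jacobi 2 k" if "odd k" for k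
    using jacobi_mult_left[OF that, of "-1" 2] by simp
  have "jacobi 2 n = jacobi (n + 2) n"
    by (rule jacobi_cong) (simp add: cong_def)
  also have "\<dots> = jacobi n (n + 2)" using assms o by (intro jacobi_swap) auto
  also have "\<dots> = jacobi (-2) (n + 2)"
    by (rule jacobi_cong) (simp add: cong_iff_dvd_diff algebra_simps)
  \<comment> \<open>The only sign change in the chain: n + 2 is 3 modulo 4, so -1 has symbol -1
    there, but symbol 1 modulo n + 4.\<close>
  also have "\<dots> = - jacobi 2 (n + 2)"
    using m[of "n + 2"] jacobi_minus_one[of "n + 2"] m4 assms o by simp
  also have "jacobi 2 (n + 2) = jacobi (n + 4) (n + 2)"
    by (rule jacobi_cong[symmetric]) (simp add: cong_iff_dvd_diff add.commute)
  also have "\<dots> = jacobi (n + 2) (n + 4)"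
    using assms m4 o by (intro jacobi_swap[symmetric]) auto
  also have "\<dots> = jacobi (-2) (n + 4)"
    by (rule jacobi_cong) (simp add: cong_iff_dvd_diff algebra_simps)
  also have "\<dots> = jacobi 2 (n + 4)"
    using m[of "n + 4"] jacobi_minus_one[of "n + 4"] m4 assms o by simp
  finally show ?thesis by simp
qed

lemma jacobi_two_add_8:
  assumes "0 < n" "n mod 4 = 1"
  shows "jacobi 2 (n + 8 * int k) = jacobi 2 n"
proof (induction k)
  case (Suc k)
  define m where "m = n + 8 * int k"
  have m: "0 < m" "m mod 4 = 1" "0 < m + 4" "(m + 4) mod 4 = 1"
    using assms unfolding m_def by presburger+
  have "n + 8 * int (Suc k) = m + 4 + 4" by (simp add: m_def)
  moreover have "jacobi 2 (m + 4 + 4) = jacobi 2 n"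
    using jacobi_two_add_4[OF m(1,2)] jacobi_two_add_4[OF m(3,4)] Suc by (simp only: m_def)
  ultimately show ?case by (simp only:)
qed simp

lemma jacobi_power_left: "odd n \<Longrightarrow> jacobi (a ^ k) n = jacobi a n ^ k"
  by (induction k) (simp_all add: jacobi_mult_left)

text \<open>By reciprocity the odd part m of x contributes a factor that depends on n modulo m only.
  If x is even, the shift is a multiple of 8, the period of (2/n).\<close>

lemma jacobi_add_4_mult:
  assumes "0 < x" "0 < n" "n mod 4 = 1" "0 \<le> k"
  shows "jacobi x (n + 4 * x * k) = jacobi x n"
proof -
  define e where "e = multiplicity 2 x"
  obtain m where m: "x = 2 ^ e * m" "odd m"
    using multiplicity_decompose'[of x 2] assms(1) unfolding e_def by auto
  have m0: "0 < m" using m(1) assms(1) by (simp add: zero_less_mult_iff)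
  define n' where "n' = n + 4 * x * k"
  have n': "0 < n'" "n' mod 4 = 1" "odd n'" "odd n"
    using assms unfolding n'_def by (auto simp: mult.assoc add_pos_nonneg) presburger+
  have "jacobi m n' = jacobi n' m" using m0 m(2) n' by (intro jacobi_swap)
  also have "\<dots> = jacobi n m"
    by (rule jacobi_cong) (simp add: n'_def cong_iff_dvd_diff m(1))
  also have "\<dots> = jacobi m n" using m0 m(2) assms by (intro jacobi_swap[symmetric])
  finally have 1: "jacobi m n' = jacobi m n" .
  have 2: "jacobi 2 n' ^ e = jacobi 2 n ^ e"
  proof (cases e)
    case (Suc f)
    have "n' = n + 8 * int (nat (2 ^ f * m * k))"
      using m0 assms(4) by (simp add: n'_def m(1) Suc)
    then have "jacobi 2 n' = jacobi 2 n" using jacobi_two_add_8[OF assms(2,3)] by metis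
    then show ?thesis by simp
  qed simp
  have "jacobi x n' = jacobi x n"
    using 1 2 n' by (simp add: m(1) jacobi_mult_left jacobi_power_left)
  then show ?thesis by (simp add: n'_def)
qed

subsection \<open>Action on Jacobi symbols\<close>

text \<open>Take for m the product of the primes of x that do not divide d. Every prime of x then
  divides exactly one of d and m e, hence not their sum.\<close>

lemma exists_coprime_add_mult:
  fixes x d e :: int
  assumes "x \<noteq> 0" "coprime d e"
  obtains m where "0 \<le> m" "coprime x (d + m * e)"
proof
  define A where "A = {p \<in> prime_factors x. \<not> p dvd d}"
  define m where "m = \<Prod>A"
  have A: "finite A" "\<And>p. p \<in> A \<Longrightarrow> prime p" by (auto simp: A_def)
  show "0 \<le> \<Prod>A" using A(2) by (intro prod_nonneg) (simp add: prime_ge_0_int)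
  show "coprime x (d + \<Prod>A * e)"
  proof (rule ccontr)
    assume "\<not> coprime x (d + \<Prod>A * e)"
    then have "\<not> is_unit (gcd x (d + m * e))" "gcd x (d + m * e) \<noteq> 0"
      using assms(1) by (auto simp: m_def is_unit_gcd)
    then obtain p where p: "prime p" "p dvd gcd x (d + m * e)"
      using prime_divisor_exists by blast
    then have px: "p dvd x" and pd: "p dvd d + m * e" by auto
    show False
    proof (cases "p dvd d")
      case True
      then have "p dvd m * e" using pd by (simp add: dvd_add_right_iff)
      moreover have "\<not> p dvd e"
        using True assms(2) p(1) by (meson coprime_common_divisor not_prime_unit)
      ultimately have "p dvd m" using p(1) prime_dvd_mult_iff by blast
      then obtain q where "q \<in> A" "p dvd q"
        using prime_dvd_prod_iff[OF A(1) p(1)] unfolding m_def by auto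
      then have "p = q" using primes_dvd_imp_eq[OF p(1) A(2)] by blast
      with \<open>q \<in> A\<close> True show False by (simp add: A_def)
    next
      case False
      then have "p \<in> A" using p(1) px assms(1) by (simp add: A_def in_prime_factors_iff)
      then have "p dvd m" unfolding m_def using A(1) by (intro dvd_prodI)
      then have "p dvd d" using pd by (simp add: dvd_add_left_iff)
      with False show False by simp
    qed
  qed
qed

text \<open>Let (X, Y) be the image. Determinant 1 gives d X - b Y = x, so (d/Y)(X/Y) = (x/Y). Here
  (x/Y) = (x/d)(x/y) because Y differs from d y by a multiple of 4x, and (d/Y) = (Y/d) = (c/d)(x/d).
  The factor (x/d) cancels since x and d are coprime, and (c/d) is its own inverse.\<close>

lemma jacobi_moebius_coprime:
  assumes det: "a * d - b * c = 1" and pos: "0 \<le> c" "0 < d" "0 < x" "0 < y"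
    and mod4: "4 dvd c" "d mod 4 = 1" "y mod 4 = 1" and cop: "coprime x d"
  shows "jacobi (a * x + b * y) (c * x + d * y) = jacobi c d * jacobi x y"
proof -
  define X Y where "X = a * x + b * y" and "Y = c * x + d * y"
  obtain c' where c': "c = 4 * c'" using mod4(1) by auto
  have odd: "odd d" "odd y" using mod4 by presburger+
  have dy: "0 < d * y" "(d * y) mod 4 = 1"
    using pos odd mod4 by (auto simp: odd_mult_mod_4)
  have Y_eq: "Y = d * y + 4 * x * c'" by (simp add: Y_def c')
  have Y: "0 < Y" "Y mod 4 = 1"
    using dy pos by (auto simp: Y_eq c' add_pos_nonneg mult.assoc)
  then have oddY: "odd Y" by presburger
  have "d * X - x = (a * d - b * c - 1) * x + b * Y"
    by (simp add: X_def Y_def algebra_simps)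
  then have "d * X - x = b * Y" by (simp add: det)
  then have "[d * X = x] (mod Y)" by (simp add: cong_iff_dvd_diff)
  then have "jacobi d Y * jacobi X Y = jacobi x Y"
    using jacobi_cong jacobi_mult_left[OF oddY] by metis
  also have "jacobi x Y = jacobi x d * jacobi x y"
    unfolding Y_eq using jacobi_add_4_mult[OF pos(3) dy] pos by (simp add: c' jacobi_mult_right)
  also have "jacobi d Y = jacobi Y d"
    using pos odd Y by (intro jacobi_swap)
  also have "jacobi Y d = jacobi (c * x) d"
    by (rule jacobi_cong) (simp add: Y_def cong_iff_dvd_diff)
  also have "\<dots> = jacobi c d * jacobi x d" using odd by (simp add: jacobi_mult_left)
  finally have *: "jacobi c d * jacobi x d * jacobi X Y = jacobi x d * jacobi x y" .
  have "b * c - (-1) = a * d" using det by linarith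
  then have "[b * c = -1] (mod d)" by (simp only: cong_iff_dvd_diff) simp
  then have "jacobi b d * jacobi c d = 1"
    using jacobi_cong jacobi_mult_left[OF odd(1)] jacobi_minus_one[OF pos(2) odd(1)] mod4(2) by metis
  then have "jacobi c d = 1 \<or> jacobi c d = -1" by (auto simp: zmult_eq_1_iff)
  with * jacobi_coprime[OF cop] show ?thesis by (auto simp: X_def Y_def)
qed

text \<open>The coprimality assumption is removed by passing from the matrix to its product with a
  lower triangular one, which changes neither the symbol of the image nor the symbol of the
  bottom row.\<close>

theorem jacobi_moebius:
  assumes det: "a * d - b * c = 1" and pos: "0 \<le> a" "0 < b" "0 \<le> c" "0 < d" "0 < x" "0 < y"
    and mod4: "4 dvd c" "d mod 4 = 1" "y mod 4 = 1"
  shows "jacobi (a * x + b * y) (c * x + d * y) = jacobi c d * jacobi x y"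
proof -
  have bottom_row: "jacobi b d * jacobi c d = 1"
    if det: "a * d - b * c = 1" and "0 < d" "d mod 4 = 1" for c d
  proof -
    have odd: "odd d" using that by presburger
    have "b * c - (-1) = a * d" using det by linarith
    then have "[b * c = -1] (mod d)" by (simp only: cong_iff_dvd_diff) simp
    then show ?thesis
      using jacobi_cong jacobi_mult_left[OF odd] jacobi_minus_one[OF _ odd] that by metis
  qed
  have "coprime d b"
  proof (rule coprimeI)
    fix k assume "k dvd d" "k dvd b"
    then have "k dvd a * d - b * c" by simp
    then show "is_unit k" using det by simp
  qed
  moreover have "coprime d 4"
  proof -
    have "odd d" using mod4(2) by presburger
    then have "coprime d (2 ^ 2)" by (subst coprime_power_right_iff) simp
    then show ?thesis by simp
  qed
  ultimately have "coprime d (4 * b)" by simp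
  then obtain m where m: "0 \<le> m" "coprime x (d + m * (4 * b))"
    using exists_coprime_add_mult[of x d "4 * b"] pos by auto
  \<comment> \<open>Left multiplication by (1, 0; 4m, 1) adds 4m times the top row to the bottom
    row. It keeps X and adds 4m X to Y, a multiple of the period of (X/Y) in Y.\<close>
  define c' d' where "c' = c + 4 * m * a" and "d' = d + 4 * b * m"
  define X Y where "X = a * x + b * y" and "Y = c * x + d * y"
  have det': "a * d' - b * c' = 1" using det by (simp add: c'_def d'_def algebra_simps)
  have pos': "0 \<le> c'" "0 < d'" using pos m(1) by (auto simp: c'_def d'_def add_pos_nonneg)
  have mod4': "4 dvd c'" "d' mod 4 = 1" using mod4 by (auto simp: c'_def d'_def mult.assoc)
  have cop': "coprime x d'" using m(2) by (simp add: d'_def algebra_simps)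
  have "0 < X" using pos by (simp add: X_def add_nonneg_pos)
  moreover have "0 < Y" using pos by (simp add: Y_def add_nonneg_pos)
  moreover have "Y mod 4 = 1"
  proof -
    have "odd d" "odd y" using mod4 by presburger+
    then have "(d * y) mod 4 = 1" using mod4 by (simp add: odd_mult_mod_4)
    moreover have "[Y = d * y] (mod 4)" using mod4(1) by (simp add: Y_def cong_iff_dvd_diff)
    ultimately show ?thesis by (simp add: cong_def)
  qed
  ultimately have "jacobi X Y = jacobi X (Y + 4 * X * m)"
    using m(1) by (intro jacobi_add_4_mult[symmetric])
  also have "Y + 4 * X * m = c' * x + d' * y"
    by (simp add: X_def Y_def c'_def d'_def algebra_simps)
  also have "jacobi X \<dots> = jacobi c' d' * jacobi x y"
    unfolding X_def using jacobi_moebius_coprime[OF det' pos' pos(5,6) mod4' mod4(3) cop'] .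
  \<comment> \<open>From b c = -1 modulo d one gets (c/d) = (b/d), and the latter has period 4b in
    d.\<close>
  also have "jacobi c' d' = jacobi c d"
  proof -
    have "jacobi b d' = jacobi b d"
      unfolding d'_def using jacobi_add_4_mult pos m(1) mod4 by simp
    then show ?thesis
      using bottom_row[OF det pos(4) mod4(2)] bottom_row[OF det' pos'(2) mod4'(2)]
      by (auto simp: zmult_eq_1_iff)
  qed
  finally show ?thesis by (simp add: X_def Y_def)
qed

lemma jacobi_2_5: "jacobi 2 5 = -1"
  using jacobi_two_add_4[of 1] by simp

definition mat2 :: "int \<Rightarrow> int \<Rightarrow> int \<Rightarrow> int \<Rightarrow> int^2^2" where
  "mat2 a b c d = vector [vector [a, b], vector [c, d]]"

lemma mat2_nth [simp]:
  "mat2 a b c d $ 1 $ 1 = a" "mat2 a b c d $ 1 $ 2 = b"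
  "mat2 a b c d $ 2 $ 1 = c" "mat2 a b c d $ 2 $ 2 = d"
  by (simp_all add: mat2_def)

lemma matrix_mult_nth_2:
  fixes A B :: "'a::comm_semiring_1^2^2"
  shows "(A ** B) $ i $ j = A $ i $ 1 * B $ 1 $ j + A $ i $ 2 * B $ 2 $ j"
  by (simp add: matrix_matrix_mult_def sum_2)

lemma matrix_vector_mult_nth_2:
  fixes A :: "'a::comm_semiring_1^2^2"
  shows "(A *v x) $ i = A $ i $ 1 * x $ 1 + A $ i $ 2 * x $ 2"
  by (simp add: matrix_vector_mult_def sum_2)

lemma mat2_eq_iff:
  fixes A B :: "int^2^2"
  shows "A = B \<longleftrightarrow> A $ 1 $ 1 = B $ 1 $ 1 \<and> A $ 1 $ 2 = B $ 1 $ 2 \<and>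
    A $ 2 $ 1 = B $ 2 $ 1 \<and> A $ 2 $ 2 = B $ 2 $ 2"
  by (auto simp: vec_eq_iff forall_2)

subsection \<open>The reciprocity obstruction\<close>

definition mat_cong :: "int \<Rightarrow> int^2^2 \<Rightarrow> int^2^2 \<Rightarrow> bool" where
  "mat_cong n A B \<longleftrightarrow> (\<forall>i j. [A $ i $ j = B $ i $ j] (mod n))"

lemma mat_cong_refl [simp]: "mat_cong n A A"
  by (simp add: mat_cong_def)

lemma mat_cong_mult: "mat_cong n A B \<Longrightarrow> mat_cong n C D \<Longrightarrow> mat_cong n (A ** C) (B ** D)"
  by (auto simp: mat_cong_def matrix_mult_nth_2 intro!: cong_add cong_mult)

primrec mat_pow :: "int^2^2 \<Rightarrow> nat \<Rightarrow> int^2^2" where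
  "mat_pow A 0 = mat 1"
| "mat_pow A (Suc k) = A ** mat_pow A k"

lemma mat_pow_in_semigroup:
  "A \<in> semigroup_generated S \<Longrightarrow> mat_pow A (Suc k) \<in> semigroup_generated S"
  by (induction k) (auto intro: semigroup_generated.mult)

definition adj2 :: "int^2^2 \<Rightarrow> int^2^2" where
  "adj2 A = mat2 (A $ 2 $ 2) (- A $ 1 $ 2) (- A $ 2 $ 1) (A $ 1 $ 1)"

lemma adj2_mult:
  assumes "det A = 1"
  shows "adj2 A ** A = mat 1"
  using assms by (simp add: mat2_eq_iff matrix_mult_nth_2 adj2_def det_2 mat_def mult.commute)

lemma adj2_mat_pow: "det A = 1 \<Longrightarrow> adj2 A ** mat_pow A (Suc k) = mat_pow A k"
  by (simp add: matrix_mul_assoc adj2_mult)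

text \<open>A power of A is the identity modulo n, so the inverse of A is congruent to a
  positive power.\<close>

lemma semigroup_contains_inverse_mod:
  assumes "A \<in> semigroup_generated S" "det A = 1" "1 \<le> n"
  obtains B where "B \<in> semigroup_generated S" "mat_cong n B (adj2 A)"
proof -
  \<comment> \<open>Even exponents make the difference l of two of them at least 2, so that A^(l-1)
    is a positive power; the identity need not lie in the semigroup.\<close>
  define f where "f k = (mat_pow A (2 * k) $ 1 $ 1 mod n, mat_pow A (2 * k) $ 1 $ 2 mod n,
    mat_pow A (2 * k) $ 2 $ 1 mod n, mat_pow A (2 * k) $ 2 $ 2 mod n)" for k
  have "range f \<subseteq> {0..<n} \<times> {0..<n} \<times> {0..<n} \<times> {0..<n}"
    using assms(3) by (auto simp: f_def)
  then have "finite (range f)" by (rule finite_subset) simp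
  then have "\<not> inj f" using finite_imageD[of f UNIV] by auto
  then obtain i j where "i < j" "f i = f j"
    unfolding inj_def by (metis linorder_neqE_nat)
  define l where "l = 2 * (j - i)"
  have "2 * i + l = 2 * j" using \<open>i < j\<close> by (simp add: l_def)
  then have "mat_cong n (mat_pow A (2 * i + l)) (mat_pow A (2 * i))"
    using \<open>f i = f j\<close> by (simp add: f_def mat_cong_def cong_def forall_2)
  moreover have "mat_cong n (mat_pow A (k + l)) (mat_pow A k) \<Longrightarrow> mat_cong n (mat_pow A l) (mat 1)" for k
  proof (induction k)
    case (Suc k)
    have "mat_cong n (adj2 A ** mat_pow A (Suc (k + l))) (adj2 A ** mat_pow A (Suc k))"
      using Suc.prems by (intro mat_cong_mult) simp_all
    then show ?case using Suc.IH unfolding adj2_mat_pow[OF assms(2)] by blast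
  qed simp
  ultimately have "mat_cong n (mat_pow A l) (mat 1)" by blast
  then have "mat_cong n (adj2 A ** mat_pow A l) (adj2 A ** mat 1)"
    by (intro mat_cong_mult) simp_all
  moreover obtain k where k: "l = Suc (Suc k)"
    using \<open>i < j\<close> unfolding l_def by (cases "j - i") auto
  ultimately have "mat_cong n (mat_pow A (Suc k)) (adj2 A)"
    unfolding k adj2_mat_pow[OF assms(2)] by simp
  then show ?thesis using that mat_pow_in_semigroup[OF assms(1)] by blast
qed

definition gen1 :: "int^2^2" where "gen1 = mat2 5 1 4 1"
definition gen2 :: "int^2^2" where "gen2 = mat2 9 2 4 1"

text \<open>With R = (1 1; 0 1) and L = (1 0; 4 1) we have gen1 = R L and gen2 = R R L, so these
  two generate the group generated by R and L.
  The word below is congruent to the inverse of R times L times the inverse of R, which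
  maps (2, 5) to (4, -7).\<close>

lemma numerator_4_mod:
  assumes "gen1 \<in> S" "gen2 \<in> S" "1 \<le> n"
  obtains M where "M \<in> semigroup_generated S" "[(M *v vector [2, 5]) $ 1 = 4] (mod n)"
proof -
  have g: "gen1 \<in> semigroup_generated S" "gen2 \<in> semigroup_generated S"
    using assms by (auto intro: semigroup_generated.gen)
  have "det gen2 = 1" by (simp add: gen2_def det_2)
  then obtain B where B: "B \<in> semigroup_generated S" "mat_cong n B (adj2 gen2)"
    using semigroup_contains_inverse_mod[OF g(2) _ assms(3)] by blast
  \<comment> \<open>For C the inverse of \<open>gen2\<close>, \<open>gen1 ** C\<close> is the
    inverse of R, so the word collapses to R^(-2) (R L) R^(-1).\<close>
  define W where "W C = gen1 ** (C ** (gen1 ** (C ** (gen1 ** (gen1 ** C)))))" for C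
  have "W B \<in> semigroup_generated S"
    unfolding W_def by (intro semigroup_generated.mult g B)
  moreover have "mat_cong n (W B) (W (adj2 gen2))"
    unfolding W_def by (intro mat_cong_mult B mat_cong_refl)
  then have "[(W B *v vector [2, 5]) $ 1 = (W (adj2 gen2) *v vector [2, 5]) $ 1] (mod n)"
    by (auto simp: mat_cong_def matrix_vector_mult_nth_2 intro!: cong_add cong_mult)
  \<comment> \<open>The denominator here is -7: the vector lies outside the range of the symbol
    invariant, which asks for positive entries.\<close>
  moreover have "(W (adj2 gen2) *v vector [2, 5]) $ 1 = 4"
    by (simp add: W_def adj2_def gen1_def gen2_def matrix_mult_nth_2 matrix_vector_mult_nth_2)
  ultimately show ?thesis using that by metis
qed

text \<open>The matrix conditions of \<open>jacobi_moebius\<close>, together with the value 1 of the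
  character (c/d).\<close>

definition symbol_preserving :: "int^2^2 \<Rightarrow> bool" where
  "symbol_preserving M \<longleftrightarrow> M \<in> SL2Z_nonneg \<and> 0 < M $ 1 $ 2 \<and> 4 dvd M $ 2 $ 1 \<and>
    M $ 2 $ 2 mod 4 = 1 \<and> jacobi (M $ 2 $ 1) (M $ 2 $ 2) = 1"

text \<open>Only the generators are assumed to preserve the symbol. A product acts one factor at a
  time, so the induction carries the conditions on the vector along and \<open>v\<close> has to
  vary.\<close>

lemma symbol_preserving_orbit:
  assumes "\<And>M. M \<in> S \<Longrightarrow> symbol_preserving M" and "M \<in> semigroup_generated S"
    and "0 < v $ 1" "0 < v $ 2" "v $ 2 mod 4 = 1"
  shows "0 < (M *v v) $ 1 \<and> 0 < (M *v v) $ 2 \<and> (M *v v) $ 2 mod 4 = 1 \<and>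
    jacobi ((M *v v) $ 1) ((M *v v) $ 2) = jacobi (v $ 1) (v $ 2)"
  using assms(2-)
proof (induction M arbitrary: v rule: semigroup_generated.induct)
  case (gen M)
  define a b c d where "a = M $ 1 $ 1" "b = M $ 1 $ 2" "c = M $ 2 $ 1" "d = M $ 2 $ 2"
  note defs = this
  have M: "a * d - b * c = 1" "0 \<le> a" "0 < b" "0 \<le> c" "0 \<le> d" "4 dvd c" "d mod 4 = 1" "jacobi c d = 1"
    using assms(1)[OF gen(1)] by (auto simp: symbol_preserving_def SL2Z_nonneg_def det_2 defs)
  have "d \<noteq> 0" using M(7) by auto
  then have d: "0 < d" using M by simp
  have "odd d" "odd (v $ 2)" using M(7) gen by presburger+
  then have "(d * v $ 2) mod 4 = 1" using gen M(7) by (simp add: odd_mult_mod_4)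
  moreover have "[c * v $ 1 + d * v $ 2 = d * v $ 2] (mod 4)"
    using M(6) by (simp add: cong_iff_dvd_diff)
  ultimately have "(c * v $ 1 + d * v $ 2) mod 4 = 1" by (simp add: cong_def)
  moreover have "0 < a * v $ 1 + b * v $ 2" "0 < c * v $ 1 + d * v $ 2"
    using M d gen by (auto intro: add_nonneg_pos)
  ultimately show ?case
    using jacobi_moebius[OF M(1-4) d gen(2,3) M(6,7) gen(4)] M(8)
    by (simp add: matrix_vector_mult_nth_2 defs)
next
  case (mult M N)
  show ?case
    using mult.IH(1)[of "N *v v"] mult.IH(2)[of v] mult.prems
    by (simp add: matrix_vector_mul_assoc[symmetric])
qed

theorem exhibits_reciprocity_obstructions_semigroup:
  assumes "\<And>M. M \<in> S \<Longrightarrow> symbol_preserving M" "gen1 \<in> S" "gen2 \<in> S"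
  shows "exhibits_reciprocity_obstructions (semigroup_generated S)"
proof -
  define v :: "int^2" where "v = vector [2, 5]"
  define X where "X = numerators (orbit (semigroup_generated S) v)"
  have X: "X = {(M *v v) $ 1 | M. M \<in> semigroup_generated S}"
    by (auto simp: X_def numerators_def orbit_def)
  have "\<exists>u\<in>X. \<exists>s::int. [u = s\<^sup>2] (mod n)" if "1 \<le> n" for n
  proof -
    obtain M where "M \<in> semigroup_generated S" "[(M *v v) $ 1 = 4] (mod n)"
      using numerator_4_mod[OF assms(2,3) \<open>1 \<le> n\<close>] by (auto simp: v_def)
    then show ?thesis
      by (intro bexI[of _ "(M *v v) $ 1"] exI[of _ 2]) (auto simp: X)
  qed
  moreover have False if u: "u \<in> X" "u = s\<^sup>2" for u s
  proof -
    obtain M where M: "M \<in> semigroup_generated S" "(M *v v) $ 1 = s\<^sup>2"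
      using u by (auto simp: X)
    define y where "y = (M *v v) $ 2"
    have "y mod 4 = 1" "jacobi (s\<^sup>2) y = -1"
      using symbol_preserving_orbit[OF assms(1) M(1), of v] M(2) jacobi_2_5
      by (auto simp: v_def y_def)
    moreover from this(1) have "odd y" by presburger
    \<comment> \<open>A square numerator would have a square as its symbol, which cannot be
      -1.\<close>
    then have "jacobi (s\<^sup>2) y = (jacobi s y)\<^sup>2"
      by (rule jacobi_power_left)
    ultimately show False by (metis zero_le_power2 neg_0_le_iff_le not_one_le_zero)
  qed
  ultimately have "square_obstruction X"
    unfolding square_obstruction_def by blast
  then show ?thesis
    unfolding exhibits_reciprocity_obstructions_def orbit_reciprocity_obstruction_def X_def
    by (intro exI[of _ v]) (simp add: v_def)
qed

subsection \<open>Counting matrices with symbol 1\<close>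

text \<open>The extreme case is {2, ..., k + 1}, where the product telescopes to 1/(k + 1). When
  elements are added in increasing order, the new maximum is at least
  \<open>card A + 2\<close>.\<close>

lemma prod_one_minus_inverse_ge:
  assumes "finite A" "\<And>p. p \<in> A \<Longrightarrow> 2 \<le> p"
  shows "(\<Prod>p\<in>A. 1 - 1 / real p) \<ge> 1 / (real (card A) + 1)"
  using assms
proof (induction A rule: finite_linorder_max_induct)
  case (insert b A)
  have "A \<subseteq> {2..<b}" using insert by auto
  then have "card A \<le> card {2..<b}" by (intro card_mono) auto
  then have b: "real (card A) + 2 \<le> real b" using insert.prems[of b] by auto
  have "1 / (real (card (insert b A)) + 1) =
      (1 - 1 / (real (card A) + 2)) * (1 / (real (card A) + 1))"
  proof -
    have "card (insert b A) = card A + 1" using insert by (subst card_insert_disjoint) auto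
    then show ?thesis by (simp add: field_simps)
  qed
  also have "\<dots> \<le> (1 - 1 / real b) * (\<Prod>p\<in>A. 1 - 1 / real p)"
  proof (rule mult_mono)
    show "1 - 1 / (real (card A) + 2) \<le> 1 - 1 / real b"
      using b by (simp add: frac_le)
    show "1 / (real (card A) + 1) \<le> (\<Prod>p\<in>A. 1 - 1 / real p)" using insert by auto
  qed (use b in auto)
  also have "\<dots> = (\<Prod>p\<in>insert b A. 1 - 1 / real p)"
    using insert by (subst prod.insert) auto
  finally show ?case .
qed simp

lemma two_power_card_prime_factors_le:
  fixes n :: nat
  assumes "0 < n"
  shows "2 ^ card (prime_factors n) \<le> n"
proof -
  have "2 ^ card (prime_factors n) = (\<Prod>p\<in>prime_factors n. 2)" by simp
  also have "\<dots> \<le> (\<Prod>p\<in>prime_factors n. p ^ multiplicity p n)"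
  proof (intro prod_mono conjI)
    fix p assume p: "p \<in> prime_factors n"
    then have "2 \<le> p" "0 < multiplicity p n"
      by (auto simp: prime_factors_multiplicity prime_ge_2_nat)
    then show "2 \<le> p ^ multiplicity p n"
      using self_le_power[of p "multiplicity p n"] by linarith
  qed simp
  also have "\<dots> = n" using prime_factorization_nat[OF assms] by simp
  finally show ?thesis .
qed

text \<open>At most log2 n distinct primes divide n. The logarithm lost here is harmless, since a
  power of N is gained for every s < 1.\<close>

lemma totient_ge:
  assumes "0 < n"
  shows "real n / (log 2 (real n) + 1) \<le> real (totient n)"
proof -
  have "real (2 ^ card (prime_factors n)) \<le> real n"
    by (rule of_nat_mono) (rule two_power_card_prime_factors_le[OF assms])
  then have "real (card (prime_factors n)) \<le> log 2 (real n)"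
    by (intro le_log_of_power) auto
  then have "1 / (log 2 (real n) + 1) \<le> 1 / (real (card (prime_factors n)) + 1)"
    by (intro frac_le) auto
  also have "\<dots> \<le> (\<Prod>p\<in>prime_factors n. 1 - 1 / real p)"
    by (intro prod_one_minus_inverse_ge) (auto dest: in_prime_factors_imp_prime prime_ge_2_nat)
  finally have "real n * (1 / (log 2 (real n) + 1)) \<le> real n * (\<Prod>p\<in>prime_factors n. 1 - 1 / real p)"
    by (intro mult_left_mono) auto
  then show ?thesis by (simp add: totient_formula2)
qed

text \<open>Multiplication by one residue of symbol -1 injects the residues of symbol -1 into those
  of symbol 1. If there is no such residue, as for square n, all totatives have symbol 1.\<close>

lemma totient_le_jacobi_one:
  assumes "1 < n" "odd n"
  shows "totient n \<le> 2 * card {k \<in> totatives n. jacobi (int k) (int n) = 1}"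
proof -
  define P where "P = {k \<in> totatives n. jacobi (int k) (int n) = 1}"
  define M where "M = {k \<in> totatives n. jacobi (int k) (int n) = -1}"
  have fin: "finite P" "finite M" by (auto simp: P_def M_def)
  have "jacobi (int k) (int n) = 1 \<or> jacobi (int k) (int n) = -1" if "k \<in> totatives n" for k
    using that by (intro jacobi_coprime) (simp add: totatives_def)
  then have "totatives n = P \<union> M" by (auto simp: P_def M_def)
  then have "totient n \<le> card P + card M"
    unfolding totient_def by (simp add: card_Un_le)
  also have "card M \<le> card P"
  proof (cases "M = {}")
    case False
    then obtain u where u: "u \<in> M" by auto
    then have cu: "coprime u n" by (auto simp: M_def totatives_def)
    have "inj_on (\<lambda>k. (u * k) mod n) M"
    proof (rule inj_onI)
      fix k l assume "k \<in> M" "l \<in> M" "(u * k) mod n = (u * l) mod n"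
      then have "[u * k = u * l] (mod n)" by (simp add: cong_def)
      then have "[k = l] (mod n)" using cu by (simp add: cong_mult_lcancel_nat)
      moreover have "k < n" "l < n"
        using \<open>k \<in> M\<close> \<open>l \<in> M\<close> totatives_less[OF _ assms(1)] by (auto simp: M_def)
      ultimately show "k = l" by (simp add: cong_def)
    qed
    moreover have "(\<lambda>k. (u * k) mod n) ` M \<subseteq> P"
    proof clarify
      fix k assume k: "k \<in> M"
      then have ck: "coprime k n" by (auto simp: M_def totatives_def)
      have "jacobi (int ((u * k) mod n)) (int n) = jacobi (int u * int k) (int n)"
        by (rule jacobi_cong) (simp add: zmod_int cong_def)
      also have "\<dots> = 1" using u k assms(2) by (simp add: jacobi_mult_left M_def)
      finally have j: "jacobi (int ((u * k) mod n)) (int n) = 1" .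
      have c: "coprime ((u * k) mod n) n" using cu ck assms(1) by simp
      then have "(u * k) mod n \<noteq> 0" using assms(1) by (intro notI) simp
      then show "(u * k) mod n \<in> P"
        using c j assms(1) by (auto simp: P_def totatives_def intro: less_imp_le)
    qed
    ultimately show ?thesis using fin(1) by (rule card_inj_on_le)
  qed simp
  finally show ?thesis by (simp add: P_def)
qed

text \<open>The matrices (a, b; c, d) below map the positive half line into [3, 4]. The bounds on c and
  d make these images pairwise disjoint; c runs through a full period modulo d among the
  multiples of 4, so that half of the admissible c have symbol 1.\<close>

definition block :: "int \<Rightarrow> (int^2^2) set" where
  "block N = {M. det M = 1 \<and> N \<le> M $ 2 $ 2 \<and> M $ 2 $ 2 < 2 * N \<and> M $ 2 $ 2 mod 4 = 1 \<and>
     4 dvd M $ 2 $ 1 \<and> 4 * M $ 2 $ 2 \<le> M $ 2 $ 1 \<and> M $ 2 $ 1 < 8 * M $ 2 $ 2 \<and>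
     jacobi (M $ 2 $ 1) (M $ 2 $ 2) = 1 \<and>
     3 * M $ 2 $ 1 < M $ 1 $ 1 \<and> M $ 1 $ 1 \<le> 4 * M $ 2 $ 1 \<and>
     3 * M $ 2 $ 2 < M $ 1 $ 2 \<and> M $ 1 $ 2 \<le> 4 * M $ 2 $ 2}"

lemma finite_block: "finite (block N)"
proof -
  have "M \<in> (\<lambda>(a, b, c, d). mat2 a b c d) ` ({0..64 * N} \<times> {0..64 * N} \<times> {0..64 * N} \<times> {0..64 * N})"
    if "M \<in> block N" for M
  proof (rule image_eqI)
    show "M = (\<lambda>(a, b, c, d). mat2 a b c d) (M $ 1 $ 1, M $ 1 $ 2, M $ 2 $ 1, M $ 2 $ 2)"
      by (simp add: mat2_eq_iff)
    show "(M $ 1 $ 1, M $ 1 $ 2, M $ 2 $ 1, M $ 2 $ 2) \<in>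
      {0..64 * N} \<times> {0..64 * N} \<times> {0..64 * N} \<times> {0..64 * N}"
      using that unfolding block_def by simp
  qed
  then have "block N \<subseteq>
      (\<lambda>(a, b, c, d). mat2 a b c d) ` ({0..64 * N} \<times> {0..64 * N} \<times> {0..64 * N} \<times> {0..64 * N})"
    by blast
  then show ?thesis by (rule finite_subset) simp
qed

definition bottom_rows :: "int \<Rightarrow> int set" where
  "bottom_rows d = {c. 4 dvd c \<and> 4 * d \<le> c \<and> c < 8 * d \<and> jacobi c d = 1}"

text \<open>Symbol 1 forces c and d to be coprime, so (c, d) completes to determinant 1 with a the
  inverse of d modulo c.\<close>

lemma bottom_row_in_block:
  assumes "2 \<le> N" "N \<le> d" "d < 2 * N" "d mod 4 = 1" "c \<in> bottom_rows d"
  obtains M where "M \<in> block N" "M $ 2 $ 1 = c" "M $ 2 $ 2 = d"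
proof -
  have c: "4 dvd c" "4 * d \<le> c" "c < 8 * d" "jacobi c d = 1"
    using assms(5) by (auto simp: bottom_rows_def)
  have c1: "1 < c" "0 < d" using assms c by linarith+
  have "coprime c d"
    using jacobi_not_coprime[of c d] c(4) c1 by force
  then have "coprime d c" by (simp add: coprime_commute)
  then obtain a0 where a0: "[d * a0 = 1] (mod c)" using cong_solve_coprime_int by blast
  define a where "a = a0 mod c"
  have "[d * a = 1] (mod c)" using a0 by (simp add: a_def cong_def mod_mult_right_eq)
  then have dvd: "c dvd a * d - 1" by (simp add: cong_iff_dvd_diff mult.commute)
  then obtain b where b: "a * d - 1 = c * b" by auto
  have a: "0 \<le> a" "a < c" using c1 by (auto simp: a_def)
  have "a \<noteq> 0" using dvd c1 by auto
  then have a1: "1 \<le> a" using a by simp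
  \<comment> \<open>N >= 2 enters here: for d = 1 the completion would be a = 1, b = 0.\<close>
  have "1 * 2 \<le> a * d" using a1 assms by (intro mult_mono) auto
  then have "0 < c * b" using b by linarith
  then have b1: "1 \<le> b" using c1 by (simp add: zero_less_mult_iff)
  have "c * b < c * d"
  proof -
    have "a * d < c * d" using a(2) c1 by simp
    then show ?thesis using b by linarith
  qed
  then have b2: "b < d" using c1 by simp
  \<comment> \<open>Adding three times the bottom row to the top one translates the image by 3, from
    [0, 1] into [3, 4].\<close>
  define M where "M = mat2 (a + 3 * c) (b + 3 * d) c d"
  have "det M = 1" using b by (simp add: M_def det_2 algebra_simps)
  then have "M \<in> block N" using assms c a a1 b1 b2 by (simp add: M_def block_def)
  then show ?thesis using that by (simp add: M_def)
qed

text \<open>The rows are c = 4 (k + n) with k a totative; since 4 is a square, (c/n) =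
  (k/n).\<close>

lemma card_bottom_rows:
  assumes "1 < n" "odd n"
  shows "totient n \<le> 2 * card (bottom_rows (int n))"
proof -
  define P where "P = {k \<in> totatives n. jacobi (int k) (int n) = 1}"
  have "(\<lambda>k. 4 * (int k + int n)) ` P \<subseteq> bottom_rows (int n)"
  proof clarify
    fix k assume k: "k \<in> P"
    then have kn: "k < n" "coprime (int k) (int n)" "jacobi (int k) (int n) = 1"
      using totatives_less[OF _ assms(1)] by (auto simp: P_def totatives_def coprime_int_iff)
    have odd: "odd (int n)" using assms by simp
    have "jacobi (4 * (int k + int n)) (int n) = jacobi (4 * int k) (int n)"
      by (rule jacobi_cong) (simp add: cong_iff_dvd_diff algebra_simps)
    also have "\<dots> = (jacobi 2 (int n))\<^sup>2"
      using jacobi_mult_left[OF odd, of 4 "int k"] jacobi_power_left[OF odd, of 2 2] kn by simp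
    also have "\<dots> = 1" using jacobi_coprime[of 2 "int n"] odd by auto
    finally show "4 * (int k + int n) \<in> bottom_rows (int n)"
      using kn by (simp add: bottom_rows_def)
  qed
  moreover have "inj_on (\<lambda>k. 4 * (int k + int n)) P" by (auto simp: inj_on_def)
  moreover have "finite (bottom_rows (int n))"
    by (rule finite_subset[of _ "{4 * int n..8 * int n}"]) (auto simp: bottom_rows_def)
  ultimately have "card P \<le> card (bottom_rows (int n))" by (intro card_inj_on_le)
  then show ?thesis using totient_le_jacobi_one[OF assms] by (simp add: P_def)
qed

text \<open>For N = 4m there are m numbers 4j + 1 in [4m, 8m), and each is the entry d of at least
  \<open>totient d / 2\<close> matrices, told apart by their bottom rows.\<close>

lemma card_block_ge:
  fixes m :: nat
  assumes "1 \<le> m"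
  shows "2 * (real m)\<^sup>2 / (log 2 (8 * real m) + 1) \<le> real (card (block (4 * int m)))"
proof -
  define D where "D = (\<lambda>j::nat. 4 * j + 1) ` {m..<2 * m}"
  define Q where "Q = (SIGMA n:D. bottom_rows (int n))"
  have D: "4 * m \<le> n" "n < 8 * m" "n mod 4 = 1" "1 < n" "odd n" if "n \<in> D" for n
    using that assms by (auto simp: D_def)
  have finB: "finite (bottom_rows d)" for d
    by (rule finite_subset[of _ "{4 * d..8 * d}"]) (auto simp: bottom_rows_def)
  have "(\<lambda>(n, c). (int n, c)) ` Q \<subseteq> (\<lambda>M. (M $ 2 $ 2, M $ 2 $ 1)) ` block (4 * int m)"
  proof clarify
    fix n c assume "(n, c) \<in> Q"
    then have n: "n \<in> D" "c \<in> bottom_rows (int n)" by (auto simp: Q_def)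
    have "int n mod 4 = 1" using D(3)[OF n(1)] by presburger
    then obtain M where "M \<in> block (4 * int m)" "M $ 2 $ 1 = c" "M $ 2 $ 2 = int n"
      using bottom_row_in_block[of "4 * int m" "int n" c] D[OF n(1)] n(2) assms by auto
    then show "(int n, c) \<in> (\<lambda>M. (M $ 2 $ 2, M $ 2 $ 1)) ` block (4 * int m)" by force
  qed
  moreover have "inj_on (\<lambda>(n, c). (int n, c)) Q" by (auto simp: inj_on_def)
  ultimately have "card Q \<le> card ((\<lambda>M. (M $ 2 $ 2, M $ 2 $ 1)) ` block (4 * int m))"
    using finite_block by (intro card_inj_on_le) auto
  also have "\<dots> \<le> card (block (4 * int m))" by (intro card_image_le finite_block)
  finally have "card Q \<le> card (block (4 * int m))" .
  moreover have "card Q = (\<Sum>n\<in>D. card (bottom_rows (int n)))"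
    unfolding Q_def by (subst card_SigmaI) (auto simp: D_def finB)
  moreover have "2 * real m / (log 2 (8 * real m) + 1) \<le> real (card (bottom_rows (int n)))" if n: "n \<in> D" for n
  proof -
    have "4 * real m / (log 2 (8 * real m) + 1) \<le> real n / (log 2 (real n) + 1)"
    proof (rule frac_le)
      show "4 * real m \<le> real n" using D(1)[OF n] by linarith
      show "0 < log 2 (real n) + 1" using D(4)[OF n] by (intro add_nonneg_pos) auto
      have "real n \<le> 8 * real m" using D(2)[OF n] by linarith
      then show "log 2 (real n) + 1 \<le> log 2 (8 * real m) + 1" using D(4)[OF n] by simp
    qed simp
    also have "\<dots> \<le> real (totient n)" using D(4)[OF n] by (intro totient_ge) simp
    also have "\<dots> \<le> 2 * real (card (bottom_rows (int n)))"
      using card_bottom_rows[OF D(4,5)[OF n]] by linarith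
    finally show ?thesis by simp
  qed
  then have "(\<Sum>n\<in>D. 2 * real m / (log 2 (8 * real m) + 1)) \<le> (\<Sum>n\<in>D. real (card (bottom_rows (int n))))"
    by (intro sum_mono)
  moreover have "card D = m"
    unfolding D_def by (subst card_image) (auto simp: inj_on_def)
  ultimately show ?thesis by (simp add: power2_eq_square field_simps flip: of_nat_sum)
qed

lemma block_symbol_preserving:
  assumes "M \<in> block N"
  shows "symbol_preserving M"
proof -
  have *: "det M = 1" "M $ 2 $ 2 mod 4 = 1" "4 dvd M $ 2 $ 1" "jacobi (M $ 2 $ 1) (M $ 2 $ 2) = 1"
    "0 \<le> M $ 1 $ 1" "0 < M $ 1 $ 2" "0 \<le> M $ 2 $ 1" "0 \<le> M $ 2 $ 2"
    using assms by (auto simp: block_def)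
  then show ?thesis by (auto simp: symbol_preserving_def SL2Z_nonneg_def forall_2)
qed

subsection \<open>Moebius maps and Hausdorff dimension\<close>

definition moebius_den :: "int^2^2 \<Rightarrow> real \<Rightarrow> real" where
  "moebius_den M x = of_int (M $ 2 $ 1) * x + of_int (M $ 2 $ 2)"

lemma moebius_den_pos:
  assumes "M \<in> SL2Z_nonneg" "0 < x"
  shows "0 < moebius_den M x"
proof -
  have nn: "0 \<le> M $ 2 $ 1" "0 \<le> M $ 2 $ 2" and det: "M $ 1 $ 1 * M $ 2 $ 2 - M $ 1 $ 2 * M $ 2 $ 1 = 1"
    using assms(1) by (auto simp: SL2Z_nonneg_def det_2)
  have "M $ 2 $ 1 \<noteq> 0 \<or> M $ 2 $ 2 \<noteq> 0" using det by auto
  then show ?thesis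
    using nn assms(2) unfolding moebius_den_def
    by (auto simp: add_nonneg_pos add_pos_nonneg)
qed

text \<open>The one geometric identity of the proof: monotonicity, injectivity, contraction ratios
  and the relative size of the gap are all read off from it.\<close>

lemma moebius_diff:
  assumes "M \<in> SL2Z_nonneg" "0 < x" "0 < y"
  shows "moebius M x - moebius M y = (x - y) / (moebius_den M x * moebius_den M y)"
proof -
  have "M $ 1 $ 1 * M $ 2 $ 2 - M $ 1 $ 2 * M $ 2 $ 1 = 1"
    using assms(1) by (auto simp: SL2Z_nonneg_def det_2)
  then have "real_of_int (M $ 1 $ 1 * M $ 2 $ 2 - M $ 1 $ 2 * M $ 2 $ 1) = 1" by simp
  then have det: "real_of_int (M $ 1 $ 1) * of_int (M $ 2 $ 2) = 1 + of_int (M $ 1 $ 2) * of_int (M $ 2 $ 1)"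
    by simp
  have "(of_int (M $ 1 $ 1) * x + of_int (M $ 1 $ 2)) * moebius_den M y -
      (of_int (M $ 1 $ 1) * y + of_int (M $ 1 $ 2)) * moebius_den M x =
      (real_of_int (M $ 1 $ 1) * of_int (M $ 2 $ 2) - of_int (M $ 1 $ 2) * of_int (M $ 2 $ 1)) * (x - y)"
    by (simp add: moebius_den_def algebra_simps)
  also have "\<dots> = x - y" by (simp add: det)
  finally have "(of_int (M $ 1 $ 1) * x + of_int (M $ 1 $ 2)) * moebius_den M y -
      (of_int (M $ 1 $ 1) * y + of_int (M $ 1 $ 2)) * moebius_den M x = x - y" .
  then show ?thesis
    using moebius_den_pos[OF assms(1,2)] moebius_den_pos[OF assms(1,3)]
    by (simp add: moebius_def moebius_den_def[symmetric] diff_frac_eq)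
qed

lemma moebius_mult:
  assumes "N \<in> SL2Z_nonneg" "0 < x"
  shows "moebius (M ** N) x = moebius M (moebius N x)"
proof -
  have d: "moebius_den N x \<noteq> 0" using moebius_den_pos[OF assms] by simp
  define u where "u = of_int (N $ 1 $ 1) * x + of_int (N $ 1 $ 2)"
  have m: "moebius N x = u / moebius_den N x" by (simp add: moebius_def moebius_den_def u_def)
  have "moebius (M ** N) x =
      (of_int (M $ 1 $ 1) * u + of_int (M $ 1 $ 2) * moebius_den N x) /
      (of_int (M $ 2 $ 1) * u + of_int (M $ 2 $ 2) * moebius_den N x)"
    by (simp add: moebius_def matrix_mult_nth_2 moebius_den_def u_def algebra_simps)
  also have "\<dots> = ((of_int (M $ 1 $ 1) * (u / moebius_den N x) + of_int (M $ 1 $ 2)) * moebius_den N x) /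
      ((of_int (M $ 2 $ 1) * (u / moebius_den N x) + of_int (M $ 2 $ 2)) * moebius_den N x)"
    using d by (simp add: distrib_right)
  also have "\<dots> = moebius M (moebius N x)"
    using d unfolding m by (simp add: moebius_def)
  finally show ?thesis .
qed

lemma mat_1_SL2Z_nonneg: "mat 1 \<in> SL2Z_nonneg"
  by (simp add: SL2Z_nonneg_def) (simp add: mat_def)

lemma SL2Z_nonneg_mult:
  assumes "M \<in> SL2Z_nonneg" "N \<in> SL2Z_nonneg"
  shows "M ** N \<in> SL2Z_nonneg"
  using assms by (auto simp: SL2Z_nonneg_def det_mul matrix_mult_nth_2)

lemma moebius_mat_1 [simp]: "moebius (mat 1) x = x"
  by (simp add: moebius_def mat_def)

lemma moebius_mono:
  assumes "M \<in> SL2Z_nonneg" "0 < x" "x \<le> y"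
  shows "moebius M x \<le> moebius M y"
proof -
  have "0 \<le> (y - x) / (moebius_den M y * moebius_den M x)"
    using moebius_den_pos[OF assms(1), of x] moebius_den_pos[OF assms(1), of y] assms by simp
  then show ?thesis using moebius_diff[OF assms(1), of y x] assms by simp
qed

lemma continuous_on_moebius:
  assumes "M \<in> SL2Z_nonneg" "A \<subseteq> {0<..}"
  shows "continuous_on A (moebius M)"
proof -
  have "of_int (M $ 2 $ 1) * x + of_int (M $ 2 $ 2) \<noteq> (0::real)" if "x \<in> A" for x
    using moebius_den_pos[OF assms(1), of x] assms(2) that by (force simp: moebius_den_def)
  then show ?thesis
    unfolding moebius_def[abs_def] by (intro continuous_intros) auto
qed

section \<open>Criteria for Hausdorff measure and dimension\<close>

lemma diam_powr_pos_exponent: "0 < s \<Longrightarrow> diam_powr s U = ennreal (diameter U powr s)"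
  by (simp add: diam_powr_def)

lemma hausdorff_dim_le:
  assumes "0 \<le> s" "hausdorff_measure s A = 0"
  shows "hausdorff_dim A \<le> ereal s"
  unfolding hausdorff_dim_def using assms by (intro Inf_lower) auto

text \<open>Diameters are at most 1, so a larger exponent gives smaller terms. For t = 0 nonempty
  sets count 1 even at diameter 0, which is why powers are also compared with 1.\<close>

lemma hausdorff_premeasure_antimono:
  fixes A :: "'a::metric_space set"
  assumes "0 \<le> t" "t \<le> s" "0 < s" "r \<le> 1"
  shows "hausdorff_premeasure s r A \<le> hausdorff_premeasure t r A"
  unfolding hausdorff_premeasure_def
proof (rule INF_mono)
  fix U :: "nat \<Rightarrow> 'a set"
  assume U: "U \<in> {U. A \<subseteq> (\<Union>i. U i) \<and> (\<forall>i. bounded (U i) \<and> diameter (U i) \<le> r)}"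
  have "diam_powr s (U i) \<le> diam_powr t (U i)" for i
  proof -
    have d: "0 \<le> diameter (U i)" "diameter (U i) \<le> 1"
      using U assms(4) by (auto intro: diameter_ge_0 order_trans)
    have "diameter (U i) powr s \<le> diameter (U i) powr t"
      using d assms by (cases "diameter (U i) = 0") (auto intro: powr_mono')
    moreover have "diameter (U i) powr s \<le> 1"
      using d assms by (intro powr_le1) auto
    ultimately show ?thesis
      using assms by (auto simp: diam_powr_def ennreal_leI ennreal_le_1)
  qed
  then show "\<exists>V\<in>{U. A \<subseteq> (\<Union>i. U i) \<and> (\<forall>i. bounded (U i) \<and> diameter (U i) \<le> r)}.
      (\<Sum>i. diam_powr s (V i)) \<le> (\<Sum>i. diam_powr t (U i))"
    using U by (intro bexI[of _ U] suminf_le) auto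
qed

text \<open>Positivity at a single scale r is enough: it passes to every exponent t < s at the same
  scale, and the measure is the supremum over scales.\<close>

lemma hausdorff_dim_ge:
  fixes A :: "'a::metric_space set"
  assumes "0 < s" "0 < r" "r \<le> 1" "0 < hausdorff_premeasure s r A"
  shows "ereal s \<le> hausdorff_dim A"
  unfolding hausdorff_dim_def
proof (rule Inf_greatest, clarify)
  fix t assume t: "0 \<le> t" "hausdorff_measure t A = 0"
  show "ereal s \<le> ereal t"
  proof (rule ccontr)
    assume "\<not> ereal s \<le> ereal t"
    then have "hausdorff_premeasure s r A \<le> hausdorff_premeasure t r A"
      using assms t by (intro hausdorff_premeasure_antimono) auto
    also have "\<dots> \<le> hausdorff_measure t A"
      unfolding hausdorff_measure_def using assms(2) by (intro SUP_upper) auto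
    finally show False using t(2) assms(4) by simp
  qed
qed

text \<open>No condition on the mesh appears, because each diameter to the power s is bounded by the
  whole sum: a sum of at most r^s forces all diameters below r.\<close>

lemma hausdorff_measure_eq_0I:
  fixes A :: "'a::metric_space set"
  assumes "0 < s"
    and cover: "\<And>e. 0 < e \<Longrightarrow> \<exists>(I :: 'i set) V. finite I \<and> A \<subseteq> (\<Union>i\<in>I. V i) \<and>
      (\<forall>i\<in>I. bounded (V i)) \<and> (\<Sum>i\<in>I. diameter (V i) powr s) \<le> e"
  shows "hausdorff_measure s A = 0"
proof -
  have small: "hausdorff_premeasure s r A \<le> 0 + ennreal e" if r: "0 < r" and e: "0 < e" for r e
  proof -
    define e' where "e' = min e (r powr s)"
    have "0 < e'" using r e by (simp add: e'_def)
    then obtain I :: "'i set" and V where I: "finite I" "A \<subseteq> (\<Union>i\<in>I. V i)"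
      and bd: "\<And>i. i \<in> I \<Longrightarrow> bounded (V i)" and sum: "(\<Sum>i\<in>I. diameter (V i) powr s) \<le> e'"
      using cover by meson
    have diam: "diameter (V i) \<le> r" if "i \<in> I" for i
    proof (rule ccontr)
      assume "\<not> diameter (V i) \<le> r"
      then have "r powr s < diameter (V i) powr s" using r assms(1) by (intro powr_less_mono2) auto
      also have "\<dots> \<le> (\<Sum>i\<in>I. diameter (V i) powr s)"
        using I(1) that by (intro member_le_sum) auto
      also have "\<dots> \<le> r powr s" using sum by (simp add: e'_def)
      finally show False by simp
    qed
    obtain h where h: "bij_betw h {0..<card I} I" using ex_bij_betw_nat_finite[OF I(1)] by blast
    define U where "U k = (if k < card I then V (h k) else {})" for k
    have hI: "h k \<in> I" if "k < card I" for k using bij_betwE[OF h] that by auto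
    have "hausdorff_premeasure s r A \<le> (\<Sum>k. diam_powr s (U k))"
      unfolding hausdorff_premeasure_def
    proof (rule INF_lower, clarify, intro conjI allI)
      show "A \<subseteq> (\<Union>i. U i)"
      proof
        fix x assume "x \<in> A"
        then obtain i where "i \<in> I" "x \<in> V i" using I(2) by auto
        moreover obtain k where "k < card I" "h k = i"
          using h \<open>i \<in> I\<close> unfolding bij_betw_def by (metis atLeastLessThan_iff imageE)
        ultimately have "x \<in> U k" by (simp add: U_def)
        then show "x \<in> (\<Union>i. U i)" by blast
      qed
      fix i
      show "bounded (U i)" using bd hI by (simp add: U_def)
      show "diameter (U i) \<le> r" using diam hI r by (simp add: U_def)
    qed
    also have "\<dots> = (\<Sum>k\<in>{0..<card I}. diam_powr s (U k))"
      by (rule suminf_finite) (auto simp: U_def diam_powr_def)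
    also have "\<dots> = (\<Sum>k\<in>{0..<card I}. ennreal (diameter (V (h k)) powr s))"
      by (intro sum.cong) (auto simp: U_def diam_powr_pos_exponent[OF assms(1)])
    also have "\<dots> = (\<Sum>i\<in>I. ennreal (diameter (V i) powr s))"
      by (rule sum.reindex_bij_betw[OF h])
    also have "\<dots> = ennreal (\<Sum>i\<in>I. diameter (V i) powr s)"
      by (intro sum_ennreal) auto
    also have "\<dots> \<le> ennreal e" using sum by (intro ennreal_leI) (simp add: e'_def)
    finally show ?thesis by simp
  qed
  have "hausdorff_premeasure s r A \<le> 0" if r: "0 < r" for r
    by (rule ennreal_le_epsilon) (rule small[OF r])
  then have "hausdorff_measure s A \<le> 0"
    unfolding hausdorff_measure_def by (intro SUP_least) auto
  then show ?thesis by simp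
qed

subsection \<open>Lower bound for the dimension\<close>

text \<open>An iterated function system with strong separation. The interval [1, 4] contains the
  base point 1 of the limit set.\<close>

locale moebius_system =
  fixes S :: "(int^2^2) set"
  assumes fin: "finite S"
    and nonneg: "M \<in> S \<Longrightarrow> M \<in> SL2Z_nonneg"
    and maps: "M \<in> S \<Longrightarrow> x \<in> {1..4} \<Longrightarrow> moebius M x \<in> {1..4}"
    and disj: "M \<in> S \<Longrightarrow> N \<in> S \<Longrightarrow> M \<noteq> N \<Longrightarrow> moebius M ` {1..4} \<inter> moebius N ` {1..4} = {}"
begin

lemma compact_image: "M \<in> SL2Z_nonneg \<Longrightarrow> compact (moebius M ` {1..4})"
  by (intro compact_continuous_image continuous_on_moebius) auto

lemma exists_gap:
  obtains \<delta> where "0 < \<delta>"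
    "\<And>M N x y. M \<in> S \<Longrightarrow> N \<in> S \<Longrightarrow> M \<noteq> N \<Longrightarrow> x \<in> {1..4} \<Longrightarrow> y \<in> {1..4} \<Longrightarrow>
      \<delta> \<le> \<bar>moebius M x - moebius N y\<bar>"
proof -
  have "\<exists>d>0. \<forall>x\<in>{1..4}. \<forall>y\<in>{1..4}. d \<le> \<bar>moebius M x - moebius N y\<bar>"
    if "M \<in> S" "N \<in> S" "M \<noteq> N" for M N
  proof -
    obtain d where "0 < d" "\<forall>x\<in>moebius M ` {1..4}. \<forall>y\<in>moebius N ` {1..4}. d \<le> dist x y"
      using separate_compact_closed[OF compact_image compact_imp_closed[OF compact_image] disj] nonneg \<open>M \<in> S\<close> \<open>N \<in> S\<close> \<open>M \<noteq> N\<close>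
      by metis
    then show ?thesis by (intro exI[of _ d]) (auto simp: dist_real_def)
  qed
  then obtain d where d: "\<And>M N. M \<in> S \<Longrightarrow> N \<in> S \<Longrightarrow> M \<noteq> N \<Longrightarrow> 0 < d M N"
    "\<And>M N x y. M \<in> S \<Longrightarrow> N \<in> S \<Longrightarrow> M \<noteq> N \<Longrightarrow> x \<in> {1..4} \<Longrightarrow> y \<in> {1..4} \<Longrightarrow>
      d M N \<le> \<bar>moebius M x - moebius N y\<bar>"
    by metis
  define P where "P = {(M, N). M \<in> S \<and> N \<in> S \<and> M \<noteq> N}"
  have "finite P" by (rule finite_subset[of _ "S \<times> S"]) (auto simp: P_def fin)
  \<comment> \<open>The inserted 1 covers systems with at most one map, where there is no pair to
    separate.\<close>
  define \<delta> where "\<delta> = Min (insert 1 ((\<lambda>(M, N). d M N) ` P))"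
  show ?thesis
  proof
    show "0 < \<delta>" unfolding \<delta>_def using \<open>finite P\<close> d(1) by (subst Min_gr_iff) (auto simp: P_def)
    fix M N x y assume MN: "M \<in> S" "N \<in> S" "M \<noteq> N" "x \<in> {1..4::real}" "y \<in> {1..4::real}"
    then have "\<delta> \<le> d M N" unfolding \<delta>_def using \<open>finite P\<close> by (intro Min_le) (auto simp: P_def image_iff)
    with d(2)[OF MN] show "\<delta> \<le> \<bar>moebius M x - moebius N y\<bar>" by linarith
  qed
qed

text \<open>A greedy construction of a limit point outside all the sets U i. At level n the current
  cylinder meets only sets of index i with n \<le> g i; such a set is too small to meet two of
  its subcylinders, so some subcylinder inherits at most its share of the total weight.\<close>

lemma exists_uncovered_limit_point:
  assumes r: "0 < r" "r < 1" and q: "0 \<le> q" "q < 1"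
    and lower: "\<And>M x y. M \<in> S \<Longrightarrow> x \<in> {1..4} \<Longrightarrow> y \<in> {1..4} \<Longrightarrow>
      r * \<bar>x - y\<bar> \<le> \<bar>moebius M x - moebius M y\<bar>"
    and upper: "\<And>M x y. M \<in> S \<Longrightarrow> x \<in> {1..4} \<Longrightarrow> y \<in> {1..4} \<Longrightarrow>
      \<bar>moebius M x - moebius M y\<bar> \<le> q * \<bar>x - y\<bar>"
    and \<delta>: "0 < \<delta>" "\<And>M N x y. M \<in> S \<Longrightarrow> N \<in> S \<Longrightarrow> M \<noteq> N \<Longrightarrow> x \<in> {1..4} \<Longrightarrow> y \<in> {1..4} \<Longrightarrow>
      \<delta> \<le> \<bar>moebius M x - moebius N y\<bar>"
    and C: "C = real (card S)" "1 < C"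
    and U: "\<And>i. bounded (U i)" "\<And>i. diameter (U i) < \<delta> * r ^ g i"
    and sum: "summable (\<lambda>i. (1 / C) ^ Suc (g i))" "(\<Sum>i. (1 / C) ^ Suc (g i)) < 1"
  obtains l where "ereal l \<in> limit_set (semigroup_generated S)" "\<And>i. l \<notin> U i"
proof -
  let ?K = "{1..4::real}"
  define wt where "wt i = (1 / C) ^ Suc (g i)" for i
  define mt where "mt Q i = (if U i \<inter> moebius Q ` ?K \<noteq> {} then wt i else 0)" for Q i
  have wt: "summable wt" "suminf wt < 1" "\<And>i. 0 < wt i"
    using sum C(2) by (simp_all add: wt_def[abs_def] wt_def)
  have mt: "0 \<le> mt Q i" "mt Q i \<le> wt i" for Q i using wt(3)[of i] by (auto simp: mt_def)
  have mt_summable: "summable (mt Q)" for Q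
    by (rule summable_comparison_test'[OF wt(1), of 0]) (use mt in auto)
  have mt_le: "mt Q i \<le> suminf (mt Q)" for Q i
    using sum_le_suminf[OF mt_summable, of "{i}" Q] mt by simp
  \<comment> \<open>The weight bound C^(-n) is the share of a depth-n cylinder if weight 1 were
    split evenly. The clause for n = 0 fixes the start of the sequence returned by dependent
    choice.\<close>
  define admissible where "admissible n Q \<longleftrightarrow> Q \<in> SL2Z_nonneg \<and>
    (\<forall>x\<in>?K. \<forall>y\<in>?K. r ^ n * \<bar>x - y\<bar> \<le> \<bar>moebius Q x - moebius Q y\<bar>) \<and>
    (\<forall>x\<in>?K. \<forall>y\<in>?K. \<bar>moebius Q x - moebius Q y\<bar> \<le> q ^ n * \<bar>x - y\<bar>) \<and>
    suminf (mt Q) < (1 / C) ^ n \<and> (n = 0 \<longrightarrow> Q = mat 1)" for n Q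
  have sub: "moebius (Q ** M) ` ?K \<subseteq> moebius Q ` ?K" if "M \<in> S" for Q M
    using maps[OF that] moebius_mult[OF nonneg[OF that]] by (force simp: image_iff)
  have admissible_0: "admissible 0 (mat 1)"
  proof -
    have "suminf (mt (mat 1)) \<le> suminf wt" using mt(2) mt_summable wt(1) by (intro suminf_le)
    then show ?thesis using wt(2) mat_1_SL2Z_nonneg by (simp add: admissible_def)
  qed
  have admissible_step: "\<exists>Q'. admissible (Suc n) Q' \<and> (\<exists>M\<in>S. Q' = Q ** M)" if Q: "admissible n Q" for n Q
  proof -
    have *: "(\<Sum>M\<in>S. mt (Q ** M) i) \<le> mt Q i" for i
    proof (cases "\<exists>M\<in>S. U i \<inter> moebius (Q ** M) ` ?K \<noteq> {}")
      case True
      then obtain M where M: "M \<in> S" "U i \<inter> moebius (Q ** M) ` ?K \<noteq> {}" by blast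
      then have mQ: "mt Q i = wt i" using sub[OF M(1), of Q] by (auto simp: mt_def)
      \<comment> \<open>A set meeting the cylinder contributes its full weight C^(-(g i + 1)), which
        must stay below C^(-n); hence n < g i + 1.\<close>
      then have "(1 / C) ^ Suc (g i) < (1 / C) ^ n"
        using mt_le[of Q i] Q by (auto simp: admissible_def wt_def)
      then have "n \<le> g i"
        using C(2) by (subst (asm) power_strict_decreasing_iff) auto
      then have "r ^ g i \<le> r ^ n" using r by (intro power_decreasing) auto
      then have "diameter (U i) < \<delta> * r ^ n"
        using U(2)[of i] \<delta>(1) by (meson less_le_trans mult_left_mono less_imp_le)
      have "mt (Q ** N) i = 0" if N: "N \<in> S" "N \<noteq> M" for N
      proof (rule ccontr)
        assume "mt (Q ** N) i \<noteq> 0"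
        then have "U i \<inter> moebius (Q ** N) ` ?K \<noteq> {}" by (auto simp: mt_def split: if_splits)
        then obtain y where y: "y \<in> ?K" "moebius (Q ** N) y \<in> U i" by blast
        obtain x where x: "x \<in> ?K" "moebius (Q ** M) x \<in> U i" using M(2) by blast
        have "r ^ n * \<delta> \<le> r ^ n * \<bar>moebius M x - moebius N y\<bar>"
          using \<delta>(2)[of M N x y] N M(1) x(1) y(1) r by (intro mult_left_mono) auto
        also have "\<dots> \<le> \<bar>moebius Q (moebius M x) - moebius Q (moebius N y)\<bar>"
          using Q maps[OF M(1) x(1)] maps[OF N(1) y(1)] unfolding admissible_def by blast
        also have "\<dots> = dist (moebius (Q ** M) x) (moebius (Q ** N) y)"
          using x(1) y(1) by (simp add: moebius_mult[OF nonneg[OF M(1)]] moebius_mult[OF nonneg[OF N(1)]] dist_real_def)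
        also have "\<dots> \<le> diameter (U i)" by (rule diameter_bounded_bound[OF U(1) x(2) y(2)])
        finally show False using \<open>diameter (U i) < \<delta> * r ^ n\<close> by (simp add: mult.commute)
      qed
      then have "(\<Sum>N\<in>S. mt (Q ** N) i) = (\<Sum>N\<in>{M}. mt (Q ** N) i)"
        using M(1) fin by (intro sum.mono_neutral_right) auto
      then show ?thesis using mt(2)[of "Q ** M" i] mQ by simp
    next
      case False
      then have "(\<Sum>M\<in>S. mt (Q ** M) i) = 0" by (intro sum.neutral) (auto simp: mt_def)
      then show ?thesis using mt(1)[of Q i] by simp
    qed
    have "(\<Sum>M\<in>S. suminf (mt (Q ** M))) = (\<Sum>i. \<Sum>M\<in>S. mt (Q ** M) i)"
      by (rule suminf_sum[symmetric]) (rule mt_summable)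
    also have "\<dots> \<le> suminf (mt Q)"
      using * mt_summable by (intro suminf_le summable_sum)
    also have "\<dots> < (1 / C) ^ n" using Q by (simp add: admissible_def)
    also have "\<dots> = (\<Sum>M\<in>S. (1 / C) ^ Suc n)" using C by (simp add: field_simps)
    finally obtain M where M: "M \<in> S" "suminf (mt (Q ** M)) < (1 / C) ^ Suc n"
      by (meson not_le sum_mono)
    have "admissible (Suc n) (Q ** M)"
    proof -
      have QS: "Q \<in> SL2Z_nonneg" using Q by (simp add: admissible_def)
      have "r ^ Suc n * \<bar>x - y\<bar> \<le> \<bar>moebius (Q ** M) x - moebius (Q ** M) y\<bar> \<and>
          \<bar>moebius (Q ** M) x - moebius (Q ** M) y\<bar> \<le> q ^ Suc n * \<bar>x - y\<bar>"
        if xy: "x \<in> ?K" "y \<in> ?K" for x y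
      proof
        have e: "\<bar>moebius (Q ** M) x - moebius (Q ** M) y\<bar> =
            \<bar>moebius Q (moebius M x) - moebius Q (moebius M y)\<bar>"
          using xy by (simp add: moebius_mult[OF nonneg[OF M(1)]])
        have "r ^ n * (r * \<bar>x - y\<bar>) \<le> r ^ n * \<bar>moebius M x - moebius M y\<bar>"
          using lower[OF M(1) xy] r by (intro mult_left_mono) auto
        also have "\<dots> \<le> \<bar>moebius Q (moebius M x) - moebius Q (moebius M y)\<bar>"
          using Q maps[OF M(1) xy(1)] maps[OF M(1) xy(2)] unfolding admissible_def by blast
        finally show "r ^ Suc n * \<bar>x - y\<bar> \<le> \<bar>moebius (Q ** M) x - moebius (Q ** M) y\<bar>"
          unfolding e by (simp add: algebra_simps)
        have "\<bar>moebius Q (moebius M x) - moebius Q (moebius M y)\<bar> \<le> q ^ n * \<bar>moebius M x - moebius M y\<bar>"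
          using Q maps[OF M(1) xy(1)] maps[OF M(1) xy(2)] unfolding admissible_def by blast
        also have "\<dots> \<le> q ^ n * (q * \<bar>x - y\<bar>)"
          using upper[OF M(1) xy] q by (intro mult_left_mono) auto
        finally show "\<bar>moebius (Q ** M) x - moebius (Q ** M) y\<bar> \<le> q ^ Suc n * \<bar>x - y\<bar>"
          unfolding e by (simp add: algebra_simps)
      qed
      then show ?thesis
        unfolding admissible_def using M(2) SL2Z_nonneg_mult[OF QS nonneg[OF M(1)]] by blast
    qed
    then show ?thesis using M(1) by blast
  qed
  obtain Q where Q: "\<And>n. admissible n (Q n)" "\<And>n. \<exists>M\<in>S. Q (Suc n) = Q n ** M"
    using dependent_nat_choice[of admissible "\<lambda>_ Q Q'. \<exists>M\<in>S. Q' = Q ** M"] admissible_0 admissible_step by metis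
  then obtain \<gamma> where \<gamma>: "\<And>n. \<gamma> n \<in> S" "\<And>n. Q (Suc n) = Q n ** \<gamma> n" by metis
  have Q0: "Q 0 = mat 1" using Q(1)[of 0] by (simp add: admissible_def)
  have pp: "partial_prod \<gamma> n = Q (Suc n)" for n
    by (induction n) (simp_all add: \<gamma>(2) Q0)
  have QS: "Q n \<in> SL2Z_nonneg" for n using Q(1)[of n] by (simp add: admissible_def)
  have "moebius (Q (Suc n)) ` ?K \<subseteq> moebius (Q n) ` ?K" for n
    using sub[OF \<gamma>(1)] by (simp add: \<gamma>(2))
  then have "decseq (\<lambda>n. moebius (Q n) ` ?K)" by (rule decseq_SucI)
  then have "\<Inter>(range (\<lambda>n. moebius (Q n) ` ?K)) \<noteq> {}"
    using compact_image[OF QS] by (intro compact_nest) (auto simp: decseq_def)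
  then obtain l where l: "\<And>n. l \<in> moebius (Q n) ` ?K" by auto
  have "(\<lambda>n. moebius (partial_prod \<gamma> n) 1) \<longlonglongrightarrow> l"
  proof (rule LIM_zero_cancel, rule Lim_null_comparison)
    show "\<forall>\<^sub>F n in sequentially. norm (moebius (partial_prod \<gamma> n) 1 - l) \<le> q ^ Suc n * 3"
    proof (intro always_eventually allI)
      fix n
      obtain x where x: "x \<in> ?K" "l = moebius (Q (Suc n)) x" using l[of "Suc n"] by auto
      have "1 \<in> ?K" by simp
      then have "\<bar>moebius (Q (Suc n)) 1 - l\<bar> \<le> q ^ Suc n * \<bar>1 - x\<bar>"
        using Q(1)[of "Suc n"] x unfolding admissible_def by blast
      also have "\<dots> \<le> q ^ Suc n * 3" using x(1) q by (intro mult_left_mono) auto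
      finally show "norm (moebius (partial_prod \<gamma> n) 1 - l) \<le> q ^ Suc n * 3"
        using q by (simp add: pp)
    qed
    have "(\<lambda>n. q ^ n * q * 3) \<longlonglongrightarrow> 0 * q * 3"
      using q by (intro tendsto_intros LIMSEQ_power_zero) auto
    then show "(\<lambda>n. q ^ Suc n * 3) \<longlonglongrightarrow> 0" by (simp add: mult.commute mult.left_commute)
  qed
  moreover have "\<gamma> j \<in> semigroup_generated S - {mat 1}" for j
  proof -
    have "\<gamma> j \<noteq> mat 1"
    proof
      assume "\<gamma> j = mat 1"
      then have "\<bar>4 - 1\<bar> \<le> q * \<bar>4 - 1::real\<bar>" using upper[OF \<gamma>(1)[of j], of 4 1] by simp
      then show False using q by simp
    qed
    then show ?thesis using \<gamma>(1) by (auto intro: semigroup_generated.gen)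
  qed
  ultimately have "ereal l \<in> limit_set (semigroup_generated S)"
    unfolding limit_set_def by (auto intro!: exI[of _ \<gamma>])
  \<comment> \<open>At depth g i + 1 the weight of \<open>U i\<close> alone would already equal the
    bound C^(-(g i + 1)).\<close>
  moreover have "l \<notin> U i" for i
  proof
    assume "l \<in> U i"
    then have "mt (Q (Suc (g i))) i = wt i" using l[of "Suc (g i)"] by (auto simp: mt_def)
    then show False
      using mt_le[of "Q (Suc (g i))" i] Q(1)[of "Suc (g i)"] by (simp add: admissible_def wt_def)
  qed
  ultimately show ?thesis using that by blast
qed

text \<open>A cover with sum below \<delta>^s / 2 would miss a limit point. Choosing g with \<delta>
  r^(g+1) <= diameter < \<delta> r^g, the hypothesis C r^s >= 1 gives C^(-(g+1)) <= (diameter /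
  \<delta>)^s, so the weights are controlled by the sum of the cover.\<close>

theorem semigroup_dim_ge:
  assumes r: "0 < r" "r < 1" and q: "0 \<le> q" "q < 1"
    and lower: "\<And>M x y. M \<in> S \<Longrightarrow> x \<in> {1..4} \<Longrightarrow> y \<in> {1..4} \<Longrightarrow>
      r * \<bar>x - y\<bar> \<le> \<bar>moebius M x - moebius M y\<bar>"
    and upper: "\<And>M x y. M \<in> S \<Longrightarrow> x \<in> {1..4} \<Longrightarrow> y \<in> {1..4} \<Longrightarrow>
      \<bar>moebius M x - moebius M y\<bar> \<le> q * \<bar>x - y\<bar>"
    and s: "0 < s" and card: "1 \<le> real (card S) * r powr s"
  shows "ereal s \<le> semigroup_dim (semigroup_generated S)"
proof -
  define C where "C = real (card S)"
  define \<Lambda> where "\<Lambda> = {x :: real. ereal x \<in> limit_set (semigroup_generated S)}"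
  have rs: "0 < r powr s" "r powr s < 1" using r s powr_less_mono2[of s r 1] by auto
  have C: "1 < C"
  proof (rule ccontr)
    assume "\<not> 1 < C"
    then have "C * r powr s \<le> 1 * r powr s" using rs by (intro mult_right_mono) auto
    then show False using rs card by (simp add: C_def)
  qed
  have Cr: "1 / C \<le> r powr s" using card C by (simp add: C_def field_simps)
  obtain \<delta> where \<delta>: "0 < \<delta>" "\<And>M N x y. M \<in> S \<Longrightarrow> N \<in> S \<Longrightarrow> M \<noteq> N \<Longrightarrow> x \<in> {1..4} \<Longrightarrow> y \<in> {1..4} \<Longrightarrow>
      \<delta> \<le> \<bar>moebius M x - moebius N y\<bar>"
    using exists_gap by blast
  \<comment> \<open>Below \<delta> so that g = 0 is always allowed as a start, and at most 1 for the
    dimension criterion.\<close>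
  define \<eta> where "\<eta> = min 1 (\<delta> / 2)"
  have \<eta>: "0 < \<eta>" "\<eta> \<le> 1" "\<eta> < \<delta>" using \<delta>(1) by (auto simp: \<eta>_def)
  have "ennreal (\<delta> powr s / 2) \<le> hausdorff_premeasure s \<eta> \<Lambda>"
    unfolding hausdorff_premeasure_def
  proof (rule INF_greatest, rule ccontr)
    fix U :: "nat \<Rightarrow> real set"
    assume U: "U \<in> {U. \<Lambda> \<subseteq> (\<Union>i. U i) \<and> (\<forall>i. bounded (U i) \<and> diameter (U i) \<le> \<eta>)}"
      and "\<not> ennreal (\<delta> powr s / 2) \<le> (\<Sum>i. diam_powr s (U i))"
    then have lt: "(\<Sum>i. ennreal (diameter (U i) powr s)) < ennreal (\<delta> powr s / 2)"
      using s by (simp add: diam_powr_pos_exponent not_le)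
    then have sm: "summable (\<lambda>i. diameter (U i) powr s)"
      by (intro summable_suminf_not_top) (auto simp: top_unique)
    have "ennreal (\<Sum>i. diameter (U i) powr s) < ennreal (\<delta> powr s / 2)"
      using lt sm by (simp add: suminf_ennreal2)
    then have lt': "(\<Sum>i. diameter (U i) powr s) < \<delta> powr s / 2"
      by (simp add: ennreal_less_iff suminf_nonneg[OF sm])
    \<comment> \<open>The terms (1/2)^(i+2), with sum 1/2, pay for sets of diameter 0: for these g
      may be as large as desired, but the weight is never 0.\<close>
    have "\<exists>g. diameter (U i) < \<delta> * r ^ g \<and>
        (1 / C) ^ Suc g \<le> diameter (U i) powr s / \<delta> powr s + (1 / 2) ^ Suc (Suc i)" for i
    proof -
      have d: "0 \<le> diameter (U i)" "diameter (U i) < \<delta>"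
        using U \<eta>(3) by (auto intro: diameter_ge_0 le_less_trans)
      show ?thesis
      proof (cases "diameter (U i) = 0")
        case True
        obtain g where "(1 / C) ^ g < (1 / 2) ^ Suc (Suc i)"
          using real_arch_pow_inv[of "(1 / 2) ^ Suc (Suc i)" "1 / C"] C by auto
        moreover have "(1 / C) ^ Suc g \<le> (1 / C) ^ g" using C by (intro power_decreasing) auto
        ultimately show ?thesis using True \<delta>(1) r(1) by (intro exI[of _ g]) (simp del: power_Suc)
      next
        case False
        define P where "P k \<longleftrightarrow> \<delta> * r ^ k \<le> diameter (U i)" for k
        obtain k where "r ^ k < diameter (U i) / \<delta>"
          using real_arch_pow_inv[of "diameter (U i) / \<delta>" r] False d \<delta>(1) r by auto
        then have "P k" using \<delta>(1) by (simp add: P_def field_simps)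
        moreover have "\<not> P 0" using d by (simp add: P_def)
        ultimately obtain g where g: "\<not> P g" "P (Suc g)"
          using ex_least_nat_less[of P k] by auto
        have "(1 / C) ^ Suc g \<le> (r powr s) ^ Suc g" using Cr C by (intro power_mono) auto
        also have "\<dots> = (r ^ Suc g) powr s"
          using r by (simp add: powr_powr mult.commute del: power_Suc flip: powr_realpow)
        also have "\<dots> \<le> (diameter (U i) / \<delta>) powr s"
          using g(2) \<delta>(1) r s by (intro powr_mono2) (auto simp: P_def field_simps)
        also have "\<dots> = diameter (U i) powr s / \<delta> powr s" using d \<delta>(1) by (simp add: powr_divide)
        finally have "(1 / C) ^ Suc g \<le> diameter (U i) powr s / \<delta> powr s + (1 / 2) ^ Suc (Suc i)"
          by (simp add: add_increasing2)
        then show ?thesis using g(1) by (intro exI[of _ g]) (auto simp: P_def)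
      qed
    qed
    then obtain g where g: "\<And>i. diameter (U i) < \<delta> * r ^ g i"
      "\<And>i. (1 / C) ^ Suc (g i) \<le> diameter (U i) powr s / \<delta> powr s + (1 / 2) ^ Suc (Suc i)"
      by metis
    have geo: "(\<lambda>i. (1 / 2) ^ Suc (Suc i)) sums (1 / 2 :: real)"
      using sums_mult[OF power_half_series, of "1 / 2"] by simp
    have sm': "summable (\<lambda>i. diameter (U i) powr s / \<delta> powr s + (1 / 2) ^ Suc (Suc i))"
      using sm geo by (intro summable_add summable_divide) (auto simp: sums_iff)
    have smC: "summable (\<lambda>i. (1 / C) ^ Suc (g i))"
      by (rule summable_comparison_test'[OF sm', of 0]) (use g(2) C in auto)
    have "(\<Sum>i. (1 / C) ^ Suc (g i)) \<le> (\<Sum>i. diameter (U i) powr s / \<delta> powr s + (1 / 2) ^ Suc (Suc i))"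
      using g(2) smC sm' by (rule suminf_le)
    also have "\<dots> = (\<Sum>i. diameter (U i) powr s) / \<delta> powr s + 1 / 2"
      using suminf_add[OF summable_divide[OF sm, of "\<delta> powr s"] sums_summable[OF geo]]
        suminf_divide[OF sm, of "\<delta> powr s"] sums_unique[OF geo] by simp
    also have "\<dots> < 1" using lt' \<delta>(1) by (simp add: field_simps)
    finally have "(\<Sum>i. (1 / C) ^ Suc (g i)) < 1" .
    then obtain l where "ereal l \<in> limit_set (semigroup_generated S)" "\<And>i. l \<notin> U i"
      using exists_uncovered_limit_point[OF r q lower upper \<delta> C_def C _ g(1) smC] U by auto
    then show False using U by (auto simp: \<Lambda>_def)
  qed
  moreover have "0 < ennreal (\<delta> powr s / 2)" using \<delta>(1) by simp
  ultimately have "0 < hausdorff_premeasure s \<eta> \<Lambda>" by (rule less_le_trans[rotated])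
  then show ?thesis
    unfolding semigroup_dim_def \<Lambda>_def[symmetric] using hausdorff_dim_ge s \<eta> by blast
qed

end

subsection \<open>Upper bound for the dimension\<close>

text \<open>The tangent at u = 1 of a concave power, obtained from the convexity of exp between 0
  and ln u.\<close>

lemma powr_le_tangent:
  fixes u s :: real
  assumes "0 \<le> u" "0 < s" "s < 1"
  shows "u powr s \<le> 1 - s + s * u"
proof (cases "u = 0")
  case False
  have "exp ((1 - s) *\<^sub>R 0 + s *\<^sub>R ln u) \<le> (1 - s) * exp 0 + s * exp (ln u)"
    using assms by (intro convex_onD[OF exp_convex]) auto
  then show ?thesis using False assms by (simp add: powr_def)
qed (use assms in simp)

text \<open>The tangent bound at the even distribution t i = 1/n. As s tends to 1 the right side
  tends to the sum of the t i, so a sum below 1 remains a contraction factor for some s < 1.\<close>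

lemma sum_powr_le:
  fixes t :: "'a \<Rightarrow> real"
  assumes "finite I" "\<And>i. i \<in> I \<Longrightarrow> 0 \<le> t i" "0 < s" "s < 1"
  shows "(\<Sum>i\<in>I. t i powr s) \<le> real (card I) powr (1 - s) * (1 - s + s * (\<Sum>i\<in>I. t i))"
proof (cases "I = {}")
  case False
  define n where "n = real (card I)"
  have n: "0 < n" using False assms(1) by (simp add: n_def card_gt_0_iff)
  have "t i powr s \<le> n powr (-s) * (1 - s + s * (n * t i))" if "i \<in> I" for i
  proof -
    have "t i powr s = n powr (-s) * (n * t i) powr s"
      using n assms(2)[OF that] by (simp add: powr_mult powr_minus)
    also have "\<dots> \<le> n powr (-s) * (1 - s + s * (n * t i))"
      using n assms(2)[OF that] assms(3,4) by (intro mult_left_mono powr_le_tangent) auto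
    finally show ?thesis .
  qed
  then have "(\<Sum>i\<in>I. t i powr s) \<le> (\<Sum>i\<in>I. n powr (-s) * (1 - s + s * (n * t i)))"
    by (rule sum_mono)
  also have "\<dots> = n powr (-s) * (n * (1 - s + s * (\<Sum>i\<in>I. t i)))"
  proof -
    have "(\<Sum>i\<in>I. 1 - s + s * (n * t i)) = n * (1 - s) + s * (n * (\<Sum>i\<in>I. t i))"
      by (simp add: sum.distrib sum_distrib_left n_def)
    also have "\<dots> = n * (1 - s + s * (\<Sum>i\<in>I. t i))" by (simp add: algebra_simps)
    finally show ?thesis by (simp only: sum_distrib_left[symmetric])
  qed
  also have "\<dots> = n powr (1 - s) * (1 - s + s * (\<Sum>i\<in>I. t i))"
    using n by (simp add: powr_diff powr_minus field_simps)
  finally show ?thesis by (simp add: n_def)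
qed simp

context moebius_system
begin

definition cyl_len :: "int^2^2 \<Rightarrow> real" where
  "cyl_len Q = moebius Q 4 - moebius Q 1"

lemma cyl_len_pos: "Q \<in> SL2Z_nonneg \<Longrightarrow> 0 < cyl_len Q"
  unfolding cyl_len_def using moebius_den_pos[of Q 1] moebius_den_pos[of Q 4]
  by (simp add: moebius_diff)

lemma cylinder_subset: "Q \<in> SL2Z_nonneg \<Longrightarrow> moebius Q ` {1..4} \<subseteq> {moebius Q 1..moebius Q 4}"
  by (auto intro!: moebius_mono)

lemma moebius_image_Icc:
  assumes Q: "Q \<in> SL2Z_nonneg" and "0 < x" "x \<le> y"
  shows "moebius Q ` {x..y} = {moebius Q x..moebius Q y}"
proof
  show "moebius Q ` {x..y} \<subseteq> {moebius Q x..moebius Q y}"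
    using assms by (auto intro!: moebius_mono)
  show "{moebius Q x..moebius Q y} \<subseteq> moebius Q ` {x..y}"
  proof
    fix z assume "z \<in> {moebius Q x..moebius Q y}"
    moreover have "continuous_on {x..y} (moebius Q)"
      using assms by (intro continuous_on_moebius) auto
    ultimately show "z \<in> moebius Q ` {x..y}"
      using IVT'[of "moebius Q" x z y] assms(3) by auto
  qed
qed

lemma inj_on_moebius: "Q \<in> SL2Z_nonneg \<Longrightarrow> inj_on (moebius Q) {0<..}"
proof (rule inj_onI)
  fix x y assume Q: "Q \<in> SL2Z_nonneg" and xy: "x \<in> {0<..}" "y \<in> {0<..}" "moebius Q x = moebius Q y"
  then have "(x - y) / (moebius_den Q x * moebius_den Q y) = 0" using moebius_diff[OF Q, of x y] by simp
  then show "x = y" using moebius_den_pos[OF Q, of x] moebius_den_pos[OF Q, of y] xy by simp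
qed

primrec level :: "nat \<Rightarrow> (int^2^2) set" where
  "level 0 = {mat 1}"
| "level (Suc n) = (\<lambda>(Q, M). Q ** M) ` (level n \<times> S)"

lemma finite_level: "finite (level n)"
  by (induction n) (auto simp: fin)

lemma level_nonneg: "Q \<in> level n \<Longrightarrow> Q \<in> SL2Z_nonneg"
  by (induction n arbitrary: Q) (auto intro: SL2Z_nonneg_mult nonneg mat_1_SL2Z_nonneg)

lemma level_maps: "Q \<in> level n \<Longrightarrow> x \<in> {1..4} \<Longrightarrow> moebius Q x \<in> {1..4}"
proof (induction n arbitrary: Q x)
  case (Suc n)
  then obtain P M where "Q = P ** M" "P \<in> level n" "M \<in> S" by auto
  then show ?case using Suc maps[of M x] moebius_mult[OF nonneg, of M x P] by auto
qed auto

lemma level_mult: "P \<in> level m \<Longrightarrow> Q \<in> level n \<Longrightarrow> P ** Q \<in> level (m + n)"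
proof (induction n arbitrary: Q)
  case (Suc n)
  then obtain R M where "Q = R ** M" "R \<in> level n" "M \<in> S" by auto
  then show ?case using Suc by (auto simp: matrix_mul_assoc)
qed simp

lemma level_split: "Q \<in> level (n + k) \<Longrightarrow> \<exists>P\<in>level n. \<exists>R\<in>level k. Q = P ** R"
proof (induction k arbitrary: Q)
  case (Suc k)
  then obtain Q' M where "Q = Q' ** M" "Q' \<in> level (n + k)" "M \<in> S" by auto
  moreover then obtain P R where "P \<in> level n" "R \<in> level k" "Q' = P ** R" using Suc by blast
  ultimately show ?case
    by (intro bexI[of _ P] bexI[of _ "R ** M"]) (auto simp: matrix_mul_assoc)
qed auto

lemma semigroup_level: "M \<in> semigroup_generated S \<Longrightarrow> \<exists>n. M \<in> level (Suc n)"
proof (induction M rule: semigroup_generated.induct)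
  case (gen M)
  then show ?case by (intro exI[of _ 0]) force
next
  case (mult M N)
  then obtain m n where "M \<in> level (Suc m)" "N \<in> level (Suc n)" by blast
  then have "M ** N \<in> level (Suc m + Suc n)" by (rule level_mult)
  then show ?case by (metis add_Suc)
qed

text \<open>A product of k + 1 semigroup elements is a word of length at least k + 1 in the
  generators. For k >= n its first n letters place the point in a cylinder of level n, and the
  finite union of these compact cylinders is closed.\<close>

lemma limit_set_subset_level:
  assumes "ereal x \<in> limit_set (semigroup_generated S)"
  shows "x \<in> (\<Union>Q\<in>level n. moebius Q ` {1..4})"
proof -
  obtain \<gamma> where \<gamma>: "\<And>j. \<gamma> j \<in> semigroup_generated S"
    and lim: "(\<lambda>k. ereal (moebius (partial_prod \<gamma> k) 1)) \<longlonglongrightarrow> ereal x"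
    using assms by (auto simp: limit_set_def)
  have pp: "\<exists>m. partial_prod \<gamma> k \<in> level (Suc k + m)" for k
  proof (induction k)
    case 0
    then show ?case using semigroup_level[OF \<gamma>[of 0]] by auto
  next
    case (Suc k)
    then obtain m where "partial_prod \<gamma> k \<in> level (Suc k + m)" by blast
    moreover obtain l where "\<gamma> (Suc k) \<in> level (Suc l)" using semigroup_level[OF \<gamma>] by blast
    ultimately have "partial_prod \<gamma> (Suc k) \<in> level (Suc k + m + Suc l)"
      unfolding partial_prod.simps by (rule level_mult)
    moreover have "Suc k + m + Suc l = Suc (Suc k) + (m + l)" by simp
    ultimately show ?case by metis
  qed
  have "moebius (partial_prod \<gamma> k) 1 \<in> (\<Union>Q\<in>level n. moebius Q ` {1..4})" if "n \<le> k" for k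
  proof -
    obtain m where "partial_prod \<gamma> k \<in> level (Suc k + m)" using pp by blast
    moreover have "Suc k + m = n + (Suc k + m - n)" using that by simp
    ultimately obtain P R where PR: "P \<in> level n" "R \<in> level (Suc k + m - n)" "partial_prod \<gamma> k = P ** R"
      using level_split by metis
    then have "moebius (partial_prod \<gamma> k) 1 = moebius P (moebius R 1)"
      using moebius_mult[OF level_nonneg[OF PR(2)]] by simp
    moreover have "moebius R 1 \<in> {1..4}" by (rule level_maps[OF PR(2)]) simp
    ultimately show ?thesis using PR(1) by blast
  qed
  then have "\<forall>\<^sub>F k in sequentially. moebius (partial_prod \<gamma> k) 1 \<in> (\<Union>Q\<in>level n. moebius Q ` {1..4})"
    unfolding eventually_sequentially by blast
  moreover have "closed (\<Union>Q\<in>level n. moebius Q ` {1..4})"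
    using finite_level compact_image[OF level_nonneg]
    by (intro closed_UN) (auto intro: compact_imp_closed)
  moreover have "(\<lambda>k. moebius (partial_prod \<gamma> k) 1) \<longlonglongrightarrow> x" using lim by simp
  ultimately show ?thesis by (intro Lim_in_closed_set) auto
qed

text \<open>The length of the image of the gap is at least 1/30 of that of the cylinder: the ratio
  of the two is 1/12 times (c + d)(4c + d) / ((5c/2 + d)(11c/4 + d)), where c and d are the
  entries of the bottom row.\<close>

lemma sum_children_le:
  assumes Q: "Q \<in> SL2Z_nonneg"
    and gap: "\<And>M. M \<in> S \<Longrightarrow> moebius M ` {1..4} \<inter> {5/2..11/4} = {}"
  shows "(\<Sum>M\<in>S. cyl_len (Q ** M)) \<le> 29 / 30 * cyl_len Q"
proof -
  define I where "I M = {moebius (Q ** M) 1..moebius (Q ** M) 4}" for M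
  define G where "G = {moebius Q (5/2)..moebius Q (11/4)}"
  have I: "I M = moebius Q ` moebius M ` {1..4}" if "M \<in> S" for M
  proof -
    have "I M = moebius (Q ** M) ` {1..4}"
      unfolding I_def using SL2Z_nonneg_mult[OF Q nonneg[OF that]] by (subst moebius_image_Icc) auto
    also have "\<dots> = moebius Q ` moebius M ` {1..4}"
      unfolding image_image using moebius_mult[OF nonneg[OF that]] by (intro image_cong) auto
    finally show ?thesis .
  qed
  have G: "G = moebius Q ` {5/2..11/4}"
    unfolding G_def using Q by (subst moebius_image_Icc) auto
  have inj: "inj_on (moebius Q) {1..4}"
    by (rule inj_on_subset[OF inj_on_moebius[OF Q]]) auto
  have sub: "moebius M ` {1..4} \<subseteq> {1..4}" if "M \<in> S" for M using maps[OF that] by blast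
  have disjI: "disjoint_family_on I S"
    unfolding disjoint_family_on_def
  proof (intro ballI impI)
    fix M N assume MN: "M \<in> S" "N \<in> S" "M \<noteq> N"
    then show "I M \<inter> I N = {}"
      using inj_on_image_Int[OF inj sub[OF MN(1)] sub[OF MN(2)]] disj[OF MN] by (simp add: I)
  qed
  have disjG: "(\<Union>M\<in>S. I M) \<inter> G = {}"
  proof -
    have "I M \<inter> G = {}" if "M \<in> S" for M
      using inj_on_image_Int[OF inj sub[OF that], of "{5/2..11/4}"] gap[OF that] by (simp add: I G that)
    then show ?thesis by blast
  qed
  have le: "moebius (Q ** M) 1 \<le> moebius (Q ** M) 4" if "M \<in> S" for M
    using cyl_len_pos[OF SL2Z_nonneg_mult[OF Q nonneg[OF that]]] by (simp add: cyl_len_def)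
  have fm: "I M \<in> fmeasurable lborel" "G \<in> fmeasurable lborel" for M
    unfolding I_def G_def by (auto intro!: fmeasurable_compact)
  have "(\<Sum>M\<in>S. cyl_len (Q ** M)) = (\<Sum>M\<in>S. measure lborel (I M))"
    using le by (intro sum.cong) (auto simp: I_def cyl_len_def)
  also have "\<dots> = measure lborel (\<Union>M\<in>S. I M)"
    using fm(1) disjI fin
    by (intro measure_finite_Union[symmetric]) (auto simp: fmeasurable_def less_top)
  finally have 1: "(\<Sum>M\<in>S. cyl_len (Q ** M)) = measure lborel (\<Union>M\<in>S. I M)" .
  have fmU: "(\<Union>M\<in>S. I M) \<in> fmeasurable lborel" using fm fin by (intro fmeasurable.finite_UN) auto
  have "measure lborel (\<Union>M\<in>S. I M) + measure lborel G = measure lborel ((\<Union>M\<in>S. I M) \<union> G)"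
    using fmU fm disjG
    by (intro measure_Union[symmetric]) (auto simp: fmeasurable_def)
  also have "\<dots> \<le> measure lborel {moebius Q 1..moebius Q 4}"
  proof (rule measure_mono_fmeasurable)
    have "moebius Q ` A \<subseteq> {moebius Q 1..moebius Q 4}" if "A \<subseteq> {1..4}" for A
      using cylinder_subset[OF Q] that by blast
    then show "(\<Union>M\<in>S. I M) \<union> G \<subseteq> {moebius Q 1..moebius Q 4}"
      using sub by (simp add: G I UN_subset_iff)
    show "{moebius Q 1..moebius Q 4} \<in> fmeasurable lborel" by (rule fmeasurable_compact) simp
  qed (use fmU fm in \<open>auto simp: fmeasurable_def\<close>)
  also have "\<dots> = cyl_len Q" using cyl_len_pos[OF Q] by (simp add: cyl_len_def)
  finally have 2: "(\<Sum>M\<in>S. cyl_len (Q ** M)) + measure lborel G \<le> cyl_len Q" using 1 by simp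
  have "cyl_len Q / 30 \<le> measure lborel G"
  proof -
    define c d where "c = real_of_int (Q $ 2 $ 1)" "d = real_of_int (Q $ 2 $ 2)"
    have cd: "0 \<le> c" "0 \<le> d" using Q by (auto simp: c_d_def SL2Z_nonneg_def)
    have den: "moebius_den Q x = c * x + d" for x by (simp add: moebius_den_def c_d_def)
    have pos: "0 < c * x + d" if "0 < x" for x using moebius_den_pos[OF Q that] by (simp add: den)
    have "measure lborel G = moebius Q (11/4) - moebius Q (5/2)"
      using moebius_mono[OF Q, of "5/2" "11/4"] by (simp add: G_def)
    also have "\<dots> = (1/4) / ((c * (11/4) + d) * (c * (5/2) + d))"
      by (subst moebius_diff[OF Q]) (auto simp: den)
    \<comment> \<open>11/4 is raised to 4 in one factor, and 5c/2 + d <= (5/2)(c + d) in the other;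
      (1/4)/(5/2) = 3/30, where 3 is the length of [1, 4].\<close>
    also have "\<dots> \<ge> (1/4) / ((c * 4 + d) * ((5/2) * (c * 1 + d)))"
      using pos[of "11/4"] pos[of "5/2"] cd by (intro divide_left_mono mult_mono mult_pos_pos) (auto intro: pos)
    also have "(1/4) / ((c * 4 + d) * ((5/2) * (c * 1 + d))) = (4 - 1) / ((c * 4 + d) * (c * 1 + d)) / 30"
    proof -
      have "(1/4) / (u * ((5/2) * v)) = (4 - 1) / (u * v) / 30" for u v :: real by simp
      then show ?thesis .
    qed
    also have "\<dots> = cyl_len Q / 30"
      unfolding cyl_len_def by (subst moebius_diff[OF Q]) (auto simp: den)
    finally show ?thesis .
  qed
  with 2 show ?thesis by simp
qed

text \<open>The factor 29/30 left by the gap at exponent 1 persists as some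
  \<open>\<theta> s < 1\<close> for an s slightly below 1. Cylinder sums at that exponent decay like
  \<open>\<theta> s ^ n\<close>, so the measure at s vanishes.\<close>

theorem semigroup_dim_less_1:
  assumes gap: "\<And>M. M \<in> S \<Longrightarrow> moebius M ` {1..4} \<inter> {5/2..11/4} = {}" and "S \<noteq> {}"
  shows "semigroup_dim (semigroup_generated S) < 1"
proof -
  define C where "C = real (card S)"
  have C: "0 < C" using fin assms(2) by (simp add: C_def card_gt_0_iff)
  define \<theta> where "\<theta> s = C powr (1 - s) * (1 - s + s * (29 / 30))" for s
  have "(\<theta> \<longlongrightarrow> C powr (1 - 1) * (1 - 1 + 1 * (29 / 30))) (at_left 1)"
    unfolding \<theta>_def[abs_def] using C by (intro tendsto_intros) auto
  then have "(\<theta> \<longlongrightarrow> 29 / 30) (at_left 1)" using C by simp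
  then have "\<forall>\<^sub>F s in at_left 1. \<theta> s < 1" by (rule order_tendstoD) simp
  moreover have "\<forall>\<^sub>F s in at_left 1. s \<in> {0<..<1::real}" by (rule eventually_at_left_real) simp
  ultimately have "\<forall>\<^sub>F s in at_left 1. \<theta> s < 1 \<and> s \<in> {0<..<1::real}" by (rule eventually_conj)
  then obtain s where s: "\<theta> s < 1" "0 < s" "s < 1"
    using eventually_happens'[OF trivial_limit_at_left_real] by auto
  have \<theta>0: "0 \<le> \<theta> s" using s by (simp add: \<theta>_def)
  have step: "(\<Sum>M\<in>S. cyl_len (Q ** M) powr s) \<le> \<theta> s * cyl_len Q powr s" if Q: "Q \<in> SL2Z_nonneg" for Q
  proof -
    have l: "0 < cyl_len Q" "\<And>M. M \<in> S \<Longrightarrow> 0 < cyl_len (Q ** M)"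
      using cyl_len_pos SL2Z_nonneg_mult Q nonneg by auto
    have "(\<Sum>M\<in>S. cyl_len (Q ** M) powr s) = (\<Sum>M\<in>S. (cyl_len (Q ** M) / cyl_len Q) powr s) * cyl_len Q powr s"
      unfolding sum_distrib_right using l by (intro sum.cong) (auto simp: powr_divide less_imp_le)
    also have "\<dots> \<le> (C powr (1 - s) * (1 - s + s * (\<Sum>M\<in>S. cyl_len (Q ** M) / cyl_len Q))) * cyl_len Q powr s"
      unfolding C_def using fin s l by (intro mult_right_mono sum_powr_le) (auto simp: less_imp_le)
    also have "\<dots> \<le> \<theta> s * cyl_len Q powr s"
    proof -
      have "(\<Sum>M\<in>S. cyl_len (Q ** M) / cyl_len Q) \<le> 29 / 30"
        using sum_children_le[OF Q gap] l by (simp add: sum_divide_distrib[symmetric] field_simps)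
      then show ?thesis
        unfolding \<theta>_def using s by (intro mult_right_mono mult_left_mono add_left_mono) auto
    qed
    finally show ?thesis .
  qed
  have level_sum: "(\<Sum>Q\<in>level n. cyl_len Q powr s) \<le> \<theta> s ^ n * 3 powr s" for n
  proof (induction n)
    case 0
    then show ?case by (simp add: cyl_len_def)
  next
    case (Suc n)
    \<comment> \<open>An inequality, because \<open>level\<close> is a set: words with the same
      product are counted once on the left.\<close>
    have "(\<Sum>Q\<in>level (Suc n). cyl_len Q powr s) \<le> (\<Sum>p\<in>level n \<times> S. cyl_len (case p of (Q, M) \<Rightarrow> Q ** M) powr s)"
      unfolding level.simps using finite_level fin by (intro order_trans[OF sum_image_le]) (auto simp: o_def)
    also have "\<dots> = (\<Sum>Q\<in>level n. \<Sum>M\<in>S. cyl_len (Q ** M) powr s)"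
      by (simp add: sum.cartesian_product case_prod_unfold)
    also have "\<dots> \<le> (\<Sum>Q\<in>level n. \<theta> s * cyl_len Q powr s)"
      using step level_nonneg by (intro sum_mono) auto
    also have "\<dots> = \<theta> s * (\<Sum>Q\<in>level n. cyl_len Q powr s)" by (simp add: sum_distrib_left)
    also have "\<dots> \<le> \<theta> s * (\<theta> s ^ n * 3 powr s)" using Suc \<theta>0 by (intro mult_left_mono)
    finally show ?case by (simp add: mult.assoc)
  qed
  have "hausdorff_measure s {x :: real. ereal x \<in> limit_set (semigroup_generated S)} = 0"
  proof (rule hausdorff_measure_eq_0I[OF s(2)])
    fix e :: real assume "0 < e"
    then obtain n where "\<theta> s ^ n < e / 3 powr s"
      using real_arch_pow_inv[of "e / 3 powr s" "\<theta> s"] s(1) by auto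
    then have n: "\<theta> s ^ n * 3 powr s < e" by (simp add: field_simps)
    have "(\<Sum>Q\<in>level n. diameter (moebius Q ` {1..4}) powr s) = (\<Sum>Q\<in>level n. cyl_len Q powr s)"
    proof (intro sum.cong refl)
      fix Q assume "Q \<in> level n"
      then have "Q \<in> SL2Z_nonneg" by (rule level_nonneg)
      then show "diameter (moebius Q ` {1..4}) powr s = cyl_len Q powr s"
        using moebius_image_Icc[of Q 1 4] cyl_len_pos[of Q]
        by (simp add: cyl_len_def diameter_closed_interval)
    qed
    then have "(\<Sum>Q\<in>level n. diameter (moebius Q ` {1..4}) powr s) \<le> e"
      using level_sum[of n] n by linarith
    then show "\<exists>(I :: (int^2^2) set) V. finite I \<and>
        {x. ereal x \<in> limit_set (semigroup_generated S)} \<subseteq> (\<Union>i\<in>I. V i) \<and>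
        (\<forall>i\<in>I. bounded (V i)) \<and> (\<Sum>i\<in>I. diameter (V i) powr s) \<le> e"
      using finite_level limit_set_subset_level compact_image[OF level_nonneg]
      by (intro exI[of _ "level n"] exI[of _ "\<lambda>Q. moebius Q ` {1..4}"])
         (auto intro: compact_imp_bounded)
  qed
  then have "semigroup_dim (semigroup_generated S) \<le> ereal s"
    unfolding semigroup_dim_def using s by (intro hausdorff_dim_le) auto
  also have "\<dots> < 1" using s by simp
  finally show ?thesis .
qed

end

subsection \<open>The semigroup\<close>

lemma hausdorff_dim_mono:
  fixes A B :: "'a::metric_space set"
  assumes "A \<subseteq> B"
  shows "hausdorff_dim A \<le> hausdorff_dim B"
proof -
  have "hausdorff_premeasure s r A \<le> hausdorff_premeasure s r B" for s r
    unfolding hausdorff_premeasure_def using assms by (intro INF_superset_mono) auto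
  then have "hausdorff_measure s A \<le> hausdorff_measure s B" for s
    unfolding hausdorff_measure_def by (intro SUP_mono) blast
  then have "hausdorff_measure s A = 0" if "hausdorff_measure s B = 0" for s
    using that by (metis le_zero_eq)
  then show ?thesis
    unfolding hausdorff_dim_def by (intro Inf_superset_mono) auto
qed

lemma semigroup_generated_mono: "S \<subseteq> T \<Longrightarrow> semigroup_generated S \<subseteq> semigroup_generated T"
proof
  fix M assume "M \<in> semigroup_generated S" "S \<subseteq> T"
  then show "M \<in> semigroup_generated T"
    by (induction M rule: semigroup_generated.induct) (auto intro: semigroup_generated.intros)
qed

lemma semigroup_dim_mono:
  assumes "\<Gamma> \<subseteq> \<Gamma>'"
  shows "semigroup_dim \<Gamma> \<le> semigroup_dim \<Gamma>'"
  unfolding semigroup_dim_def using assms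
  by (intro hausdorff_dim_mono) (fastforce simp: limit_set_def)

lemma semigroup_generated_SL2Z_nonneg:
  assumes "S \<subseteq> SL2Z_nonneg"
  shows "semigroup_generated S \<subseteq> SL2Z_nonneg"
proof
  fix M assume "M \<in> semigroup_generated S"
  then show "M \<in> SL2Z_nonneg"
    by (induction M rule: semigroup_generated.induct) (use assms SL2Z_nonneg_mult in auto)
qed

section \<open>Disjointness and contraction of the block\<close>

lemma block_entries:
  assumes "M \<in> block N" "1 \<le> N"
  shows "M $ 1 $ 1 * M $ 2 $ 2 - M $ 1 $ 2 * M $ 2 $ 1 = 1"
    "N \<le> M $ 2 $ 2" "M $ 2 $ 2 < 2 * N" "0 < M $ 2 $ 2" "0 < M $ 2 $ 1" "4 dvd M $ 2 $ 1"
    "M $ 2 $ 2 mod 4 = 1" "4 * M $ 2 $ 2 \<le> M $ 2 $ 1" "M $ 2 $ 1 < 8 * M $ 2 $ 2"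
  using assms by (auto simp: block_def det_2)

text \<open>The second column of M' is M applied to (t, u), so d' = c t + d u. Since d' < 2N, d >= N
  and c >= 4d, only t = 0 and u = 1 are possible, and the second columns agree. Then c' - c is
  divisible by d and by 4, while both entries lie in [4d, 8d).\<close>

lemma block_eq_aux:
  assumes M: "M \<in> block N" and M': "M' \<in> block N" and N: "1 \<le> N"
    and t: "0 \<le> M' $ 1 $ 2 * M $ 2 $ 2 - M $ 1 $ 2 * M' $ 2 $ 2"
    and u: "0 < M $ 1 $ 1 * M' $ 2 $ 2 - M' $ 1 $ 2 * M $ 2 $ 1"
  shows "M = M'"
proof -
  define a b c d where "a = M $ 1 $ 1" "b = M $ 1 $ 2" "c = M $ 2 $ 1" "d = M $ 2 $ 2"
  define a' b' c' d' where "a' = M' $ 1 $ 1" "b' = M' $ 1 $ 2" "c' = M' $ 2 $ 1" "d' = M' $ 2 $ 2"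
  note defs = a_b_c_d_def a'_b'_c'_d'_def
  note E = block_entries[OF M N, folded defs] and E' = block_entries[OF M' N, folded defs]
  define t u where "t = b' * d - b * d'" and "u = a * d' - b' * c"
  have tu: "0 \<le> t" "1 \<le> u" using t u by (auto simp: t_def u_def defs)
  have "d * u + c * t = (a * d - b * c) * d'" by (simp add: t_def u_def algebra_simps)
  then have d': "d' = d * u + c * t" using E(1) by simp
  have du: "d * 1 \<le> d * u" using tu E(4) by (intro mult_left_mono) auto
  have "t = 0"
  proof (rule ccontr)
    assume "t \<noteq> 0"
    then have "c * 1 \<le> c * t" using tu E(5) by (intro mult_left_mono) auto
    then show False using d' du E E' by linarith
  qed
  moreover have "u = 1"
  proof (rule ccontr)
    assume "u \<noteq> 1"
    then have "d * 2 \<le> d * u" using tu E(4) by (intro mult_left_mono) auto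
    moreover have "d' = d * u" using d' \<open>t = 0\<close> by simp
    ultimately show False using E(2) E'(3) by linarith
  qed
  ultimately have dd: "d' = d" using d' by simp
  then have bb: "b' = b" using \<open>t = 0\<close> E(4) by (simp add: t_def)
  have "(a' - a) * d = b * (c' - c)"
    using E(1) E'(1) by (simp add: dd bb algebra_simps)
  then have "d dvd b * (c' - c)" by (metis dvd_triv_right)
  moreover have "coprime d b"
  proof (rule coprimeI)
    fix k assume "k dvd d" "k dvd b"
    then have "k dvd a * d - b * c" by simp
    then show "is_unit k" using E(1) by simp
  qed
  ultimately have "d dvd c' - c" by (simp add: coprime_dvd_mult_right_iff)
  moreover have "4 dvd c' - c" using E(6) E'(6) by simp
  moreover have "coprime d 4"
  proof -
    have "odd d" using E(7) by presburger
    then have "coprime d (2 ^ 2)" by (subst coprime_power_right_iff) simp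
    then show ?thesis by simp
  qed
  ultimately have "d * 4 dvd c' - c" by (rule divides_mult)
  moreover have "\<bar>c' - c\<bar> < d * 4" using E(8,9) E'(8,9) dd by linarith
  ultimately have cc: "c' = c" using dvd_imp_le_int[of "c' - c" "d * 4"] E(4) by force
  then have "a' * d = a * d" using E(1) E'(1) unfolding dd bb cc by linarith
  then have "a' = a" using E(4) by simp
  then show ?thesis using cc dd bb by (simp add: mat2_eq_iff defs)
qed

lemma block_nonneg: "M \<in> block N \<Longrightarrow> M \<in> SL2Z_nonneg"
  using block_symbol_preserving by (simp add: symbol_preserving_def)

text \<open>The bounds are the images b/d of 0 and a/c of infinity, cleared of denominators because
  c or d may be 0.\<close>

lemma moebius_endpoints:
  assumes "M \<in> SL2Z_nonneg" "0 < x"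
  shows "of_int (M $ 1 $ 2) \<le> moebius M x * of_int (M $ 2 $ 2)"
    "moebius M x * of_int (M $ 2 $ 1) < of_int (M $ 1 $ 1)"
proof -
  define a b c d where "a = real_of_int (M $ 1 $ 1)" "b = real_of_int (M $ 1 $ 2)"
    "c = real_of_int (M $ 2 $ 1)" "d = real_of_int (M $ 2 $ 2)"
  have "M $ 1 $ 1 * M $ 2 $ 2 - M $ 1 $ 2 * M $ 2 $ 1 = 1"
    using assms(1) by (auto simp: SL2Z_nonneg_def det_2)
  then have "real_of_int (M $ 1 $ 1 * M $ 2 $ 2 - M $ 1 $ 2 * M $ 2 $ 1) = 1" by simp
  then have det: "a * d - b * c = 1" by (simp add: a_b_c_d_def)
  have pos: "0 < c * x + d" using moebius_den_pos[OF assms] by (simp add: moebius_den_def a_b_c_d_def)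
  have m: "moebius M x = (a * x + b) / (c * x + d)" by (simp add: moebius_def a_b_c_d_def)
  have "(a * x + b) * d - b * (c * x + d) = (a * d - b * c) * x" by (simp add: algebra_simps)
  then have "b * (c * x + d) \<le> (a * x + b) * d" using det assms(2) by simp
  then have "b \<le> moebius M x * d" using pos by (simp add: m field_simps)
  moreover have "a * (c * x + d) - (a * x + b) * c = a * d - b * c" by (simp add: algebra_simps)
  then have "(a * x + b) * c < a * (c * x + d)" using det by simp
  then have "moebius M x * c < a" using pos by (simp add: m field_simps)
  ultimately show "of_int (M $ 1 $ 2) \<le> moebius M x * of_int (M $ 2 $ 2)"
    "moebius M x * of_int (M $ 2 $ 1) < of_int (M $ 1 $ 1)" by (simp_all add: a_b_c_d_def)
qed

text \<open>A common point z satisfies b'/d' <= z < a/c and b/d <= z < a'/c', which gives the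
  condition u > 0 in both orders. Which of b/d and b'/d' is larger decides the order in which
  \<open>block_eq_aux\<close> applies.\<close>

lemma block_inj:
  assumes M: "M \<in> block N" and M': "M' \<in> block N" and N: "1 \<le> N"
    and "0 < x" "0 < x'" "moebius M x = moebius M' x'"
  shows "M = M'"
proof -
  define z where "z = moebius M x"
  have cross: "0 < P $ 1 $ 1 * P' $ 2 $ 2 - P' $ 1 $ 2 * P $ 2 $ 1"
    if P: "P \<in> block N" "P' \<in> block N"
      and z: "of_int (P' $ 1 $ 2) \<le> z * of_int (P' $ 2 $ 2)" "z * of_int (P $ 2 $ 1) < of_int (P $ 1 $ 1)"
    for P P'
  proof -
    have pos: "0 < P $ 2 $ 1" "0 < P' $ 2 $ 2" using block_entries P N by auto
    have "real_of_int (P' $ 1 $ 2) * of_int (P $ 2 $ 1) \<le> z * of_int (P' $ 2 $ 2) * of_int (P $ 2 $ 1)"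
      using z(1) pos by (intro mult_right_mono) auto
    also have "\<dots> = (z * of_int (P $ 2 $ 1)) * of_int (P' $ 2 $ 2)" by simp
    also have "\<dots> < of_int (P $ 1 $ 1) * of_int (P' $ 2 $ 2)"
      using z(2) pos by (intro mult_strict_right_mono) auto
    finally have "real_of_int (P' $ 1 $ 2 * P $ 2 $ 1) < of_int (P $ 1 $ 1 * P' $ 2 $ 2)" by simp
    then show ?thesis by linarith
  qed
  note z = moebius_endpoints[OF block_nonneg[OF M] assms(4), folded z_def]
    and z' = moebius_endpoints[OF block_nonneg[OF M'] assms(5), folded assms(6) z_def]
  show ?thesis
  proof (cases "0 \<le> M' $ 1 $ 2 * M $ 2 $ 2 - M $ 1 $ 2 * M' $ 2 $ 2")
    case True
    then show ?thesis using block_eq_aux[OF M M' N] cross[OF M M' z'(1) z(2)] by simp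
  next
    case False
    then show ?thesis using block_eq_aux[OF M' M N] cross[OF M' M z(1) z'(2)] by simp
  qed
qed

lemma block_range:
  assumes "M \<in> block N" "0 < x"
  shows "moebius M x \<in> {3..4}"
proof -
  have le: "3 * M $ 2 $ 1 \<le> M $ 1 $ 1" "M $ 1 $ 1 \<le> 4 * M $ 2 $ 1"
    "3 * M $ 2 $ 2 \<le> M $ 1 $ 2" "M $ 1 $ 2 \<le> 4 * M $ 2 $ 2"
    using assms(1) by (auto simp: block_def)
  have "real_of_int (3 * M $ 2 $ 1) \<le> real_of_int (M $ 1 $ 1)" "real_of_int (M $ 1 $ 1) \<le> real_of_int (4 * M $ 2 $ 1)"
    "real_of_int (3 * M $ 2 $ 2) \<le> real_of_int (M $ 1 $ 2)" "real_of_int (M $ 1 $ 2) \<le> real_of_int (4 * M $ 2 $ 2)"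
    using le by (simp_all only: of_int_le_iff)
  then have "real_of_int (3 * M $ 2 $ 1) * x \<le> real_of_int (M $ 1 $ 1) * x" "real_of_int (M $ 1 $ 1) * x \<le> real_of_int (4 * M $ 2 $ 1) * x"
    "real_of_int (3 * M $ 2 $ 2) \<le> real_of_int (M $ 1 $ 2)" "real_of_int (M $ 1 $ 2) \<le> real_of_int (4 * M $ 2 $ 2)"
    using assms(2) by (auto intro: mult_right_mono)
  then show ?thesis
    using moebius_den_pos[OF block_nonneg[OF assms(1)] assms(2)]
    by (simp add: moebius_def moebius_den_def field_simps)
qed

text \<open>On [1, 4] the denominators lie between c + d >= 2 and 4c + d, and c < 16N, d < 2N give
  4c + d < 66N.\<close>

lemma block_lipschitz:
  assumes M: "M \<in> block N" and N: "1 \<le> N" and xy: "x \<in> {1..4}" "y \<in> {1..4}"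
  shows "1 / (66 * of_int N)\<^sup>2 * \<bar>x - y\<bar> \<le> \<bar>moebius M x - moebius M y\<bar>"
    "\<bar>moebius M x - moebius M y\<bar> \<le> 1 / 4 * \<bar>x - y\<bar>"
proof -
  note E = block_entries[OF M N]
  have den: "2 \<le> moebius_den M z" "moebius_den M z \<le> 66 * of_int N" if "z \<in> {1..4}" for z
  proof -
    have c: "0 \<le> real_of_int (M $ 2 $ 1)" using E by simp
    have "real_of_int (M $ 2 $ 1) * 1 \<le> real_of_int (M $ 2 $ 1) * z" "real_of_int (M $ 2 $ 1) * z \<le> real_of_int (M $ 2 $ 1) * 4"
      using that c by (auto intro!: mult_left_mono simp del: mult_1_right)
    moreover have "2 \<le> real_of_int (M $ 2 $ 1) + real_of_int (M $ 2 $ 2)"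
    proof -
      have "2 \<le> M $ 2 $ 1 + M $ 2 $ 2" using E by linarith
      then show ?thesis by linarith
    qed
    moreover have "real_of_int (M $ 2 $ 1) * 4 + real_of_int (M $ 2 $ 2) \<le> 66 * of_int N"
    proof -
      have "M $ 2 $ 1 * 4 + M $ 2 $ 2 \<le> 66 * N" using E by linarith
      then show ?thesis by linarith
    qed
    ultimately show "2 \<le> moebius_den M z" "moebius_den M z \<le> 66 * of_int N"
      by (simp_all add: moebius_den_def)
  qed
  define D where "D = moebius_den M x * moebius_den M y"
  have "2 * 2 \<le> D" unfolding D_def using den xy by (intro mult_mono) (auto intro: order_trans[OF _ den(1)])
  moreover have "D \<le> (66 * of_int N) * (66 * of_int N)"
    unfolding D_def using den xy N by (intro mult_mono) (auto intro: order_trans[OF _ den(1)])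
  ultimately have D: "4 \<le> D" "D \<le> (66 * of_int N)\<^sup>2" by (simp_all add: power2_eq_square)
  have "\<bar>moebius M x - moebius M y\<bar> = \<bar>x - y\<bar> / D"
    using moebius_diff[OF block_nonneg[OF M], of x y] xy D by (simp add: D_def[symmetric])
  moreover have "\<bar>x - y\<bar> / (66 * of_int N)\<^sup>2 \<le> \<bar>x - y\<bar> / D" "\<bar>x - y\<bar> / D \<le> \<bar>x - y\<bar> / 4"
    using D N by (intro divide_left_mono mult_pos_pos; simp)+
  ultimately show "1 / (66 * of_int N)\<^sup>2 * \<bar>x - y\<bar> \<le> \<bar>moebius M x - moebius M y\<bar>"
    "\<bar>moebius M x - moebius M y\<bar> \<le> 1 / 4 * \<bar>x - y\<bar>" by simp_all
qed

lemma moebius_system_block: "1 \<le> N \<Longrightarrow> moebius_system (block N)"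
proof
  show "moebius M ` {1..4} \<inter> moebius M' ` {1..4} = {}"
    if "1 \<le> N" "M \<in> block N" "M' \<in> block N" "M \<noteq> M'" for M M'
  proof -
    have "moebius M x \<noteq> moebius M' y" if "x \<in> {1..4}" "y \<in> {1..4}" for x y
      using block_inj[of M N M' x y] \<open>1 \<le> N\<close> \<open>M \<in> block N\<close> \<open>M' \<in> block N\<close> \<open>M \<noteq> M'\<close> that by auto
    then show ?thesis by (auto simp: disjoint_iff image_iff)
  qed
  show "moebius M x \<in> {1..4}" if "M \<in> block N" "x \<in> {1..4}" for M x
    using block_range[OF that(1), of x] that(2) by auto
qed (auto intro: finite_block block_nonneg)

lemma gen_symbol_preserving: "symbol_preserving gen1" "symbol_preserving gen2"
  by (auto simp: symbol_preserving_def SL2Z_nonneg_def forall_2 det_2 gen1_def gen2_def)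

text \<open>Beside the block images in [3, 4] these leave the interval between 9/4 and 3 free, which
  contains the gap [5/2, 11/4].\<close>

lemma gen_range:
  assumes "x \<in> {1..4}"
  shows "moebius gen1 x \<in> {1..5/4}" "moebius gen2 x \<in> {2..9/4}"
  using assms by (auto simp: moebius_def gen1_def gen2_def field_simps)

lemma moebius_system_block_gens:
  assumes "1 \<le> N"
  shows "moebius_system (block N \<union> {gen1, gen2})"
proof -
  interpret B: moebius_system "block N" using assms by (rule moebius_system_block)
  have r: "moebius M ` {1..4} \<subseteq> {3..4}" if "M \<in> block N" for M
    using block_range[OF that] by force
  have r1: "moebius gen1 ` {1..4} \<subseteq> {1..5/4}" and r2: "moebius gen2 ` {1..4} \<subseteq> {2..9/4}"
    using gen_range by blast+
  have d: "{1..5/4} \<inter> {2..9/4::real} = {}" "{1..5/4} \<inter> {3..4::real} = {}" "{2..9/4} \<inter> {3..4::real} = {}"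
    by auto
  show ?thesis
  proof
    show "finite (block N \<union> {gen1, gen2})" using B.fin by simp
    show "M \<in> SL2Z_nonneg" if "M \<in> block N \<union> {gen1, gen2}" for M
      using that B.nonneg gen_symbol_preserving by (auto simp: symbol_preserving_def)
    show "moebius M x \<in> {1..4}" if "M \<in> block N \<union> {gen1, gen2}" "x \<in> {1..4}" for M x
      using that(1) B.maps[OF _ that(2)] gen_range[OF that(2)] by auto
    show "moebius M ` {1..4} \<inter> moebius M' ` {1..4} = {}"
      if "M \<in> block N \<union> {gen1, gen2}" "M' \<in> block N \<union> {gen1, gen2}" "M \<noteq> M'" for M M'
      using that B.disj[of M M'] r[of M] r[of M'] r1 r2 d by (elim UnE insertE emptyE) blast+
  qed
qed

text \<open>For N = 4x the first factor is the lower bound on the block size and 264 x = 66 N; the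
  product has order x^(2 - 2s) / log x.\<close>

lemma eventually_count_ge:
  fixes s :: real
  assumes "0 < s" "s < 1"
  shows "\<forall>\<^sub>F x in at_top. 1 \<le> 2 * x\<^sup>2 / (log 2 (8 * x) + 1) * (1 / (264 * x)\<^sup>2) powr s"
proof -
  have "filterlim (\<lambda>x::real. 2 * x\<^sup>2 / (log 2 (8 * x) + 1) * (1 / (264 * x)\<^sup>2) powr s) at_top at_top"
    using assms by real_asymp
  then show ?thesis by (simp add: filterlim_at_top)
qed

theorem theorem2p9:
  fixes \<epsilon> :: real
  assumes "0 < \<epsilon>"
  shows "\<exists>\<Gamma>. \<Gamma> \<subseteq> SL2Z_nonneg \<and> fin_gen_semigroup \<Gamma> \<and>
           ereal (1 - \<epsilon>) < semigroup_dim \<Gamma> \<and> semigroup_dim \<Gamma> < 1 \<and>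
           exhibits_reciprocity_obstructions \<Gamma>"
proof -
  \<comment> \<open>The 1/2 keeps s positive when \<open>\<epsilon>\<close> is large.\<close>
  define s where "s = max (1 / 2) (1 - \<epsilon> / 2)"
  have s: "0 < s" "s < 1" "1 - \<epsilon> < s" using assms by (auto simp: s_def)
  have "\<forall>\<^sub>F m::nat in sequentially. 1 \<le> 2 * (real m)\<^sup>2 / (log 2 (8 * real m) + 1) * (1 / (264 * real m)\<^sup>2) powr s"
    using eventually_count_ge[OF s(1,2)] filterlim_real_sequentially by (rule eventually_compose_filterlim)
  then obtain m0 where m0: "\<And>m::nat. m0 \<le> m \<Longrightarrow>
      1 \<le> 2 * (real m)\<^sup>2 / (log 2 (8 * real m) + 1) * (1 / (264 * real m)\<^sup>2) powr s"
    unfolding eventually_sequentially by blast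
  define m where "m = max m0 1"
  have m: "1 \<le> m" "1 \<le> 2 * (real m)\<^sup>2 / (log 2 (8 * real m) + 1) * (1 / (264 * real m)\<^sup>2) powr s"
    using m0[of m] by (auto simp: m_def)
  define N where "N = 4 * int m"
  have N: "1 \<le> N" using m by (simp add: N_def)
  interpret B: moebius_system "block N" by (rule moebius_system_block[OF N])
  define S where "S = block N \<union> {gen1, gen2}"
  interpret S: moebius_system S unfolding S_def by (rule moebius_system_block_gens[OF N])
  define \<Gamma> where "\<Gamma> = semigroup_generated S"
  define r where "r = 1 / (66 * real_of_int N)\<^sup>2"
  have r_eq: "r = 1 / (264 * real m)\<^sup>2" by (simp add: r_def N_def)
  have r: "0 < r" "r < 1"
  proof -
    have "1 < (264 * real m)\<^sup>2" using m(1) by (intro one_less_power) auto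
    then show "0 < r" "r < 1" using m(1) by (auto simp: r_eq)
  qed
  have "1 \<le> real (card (block N)) * r powr s"
  proof -
    have "2 * (real m)\<^sup>2 / (log 2 (8 * real m) + 1) * r powr s \<le> real (card (block N)) * r powr s"
      unfolding N_def by (intro mult_right_mono card_block_ge m(1)) auto
    then show ?thesis using m(2) by (simp add: r_eq)
  qed
  \<comment> \<open>The ratio bound r need not hold for \<open>gen1\<close> and \<open>gen2\<close>
    here: adding generators can only enlarge the limit set.\<close>
  then have "ereal s \<le> semigroup_dim (semigroup_generated (block N))"
    using B.semigroup_dim_ge[OF r, of "1 / 4" s] block_lipschitz[OF _ N] s by (simp add: r_def)
  also have "\<dots> \<le> semigroup_dim \<Gamma>"
    unfolding \<Gamma>_def S_def by (intro semigroup_dim_mono semigroup_generated_mono) auto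
  finally have "ereal (1 - \<epsilon>) < semigroup_dim \<Gamma>"
    using s(3) by (meson ereal_less_le less_ereal.simps(1) less_le_trans)
  moreover have "semigroup_dim \<Gamma> < 1"
    unfolding \<Gamma>_def
  proof (rule S.semigroup_dim_less_1)
    show "S \<noteq> {}" by (simp add: S_def)
    show "moebius M ` {1..4} \<inter> {5/2..11/4} = {}" if "M \<in> S" for M
    proof -
      have "moebius M x \<notin> {5/2..11/4}" if "x \<in> {1..4}" for x
        using \<open>M \<in> S\<close> block_range[of M N x] gen_range[OF that] that by (auto simp: S_def)
      then show ?thesis by blast
    qed
  qed
  moreover have "symbol_preserving M" if "M \<in> S" for M
    using that block_symbol_preserving gen_symbol_preserving by (auto simp: S_def)
  then have "exhibits_reciprocity_obstructions \<Gamma>"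
    unfolding \<Gamma>_def by (intro exhibits_reciprocity_obstructions_semigroup) (auto simp: S_def)
  moreover have "\<Gamma> \<subseteq> SL2Z_nonneg"
    unfolding \<Gamma>_def using S.nonneg by (intro semigroup_generated_SL2Z_nonneg) blast
  moreover have "fin_gen_semigroup \<Gamma>"
    unfolding fin_gen_semigroup_def \<Gamma>_def using S.fin by blast
  ultimately show ?thesis by blast
qed

end
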